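(* Let $n,t$ be integers with $1<t<n-1$, let $K$ be a field, let $I_t(C_n)\subset K[x_1,\ldots,x_n]$ be the $t$-path ideal of the $n$-cycle $C_n$, and let $F(I_t(C_n))$ be its fiber cone. Let $d=\gcd(n,t)$. Then $\dim F(I_t(C_n))=n-d+1$ (Krull dimension). In particular, $F(I_t(C_n))$ is a polynomial ring over $K$ if and only if $\gcd(n,t)=1$.
   Context: Let $S=K[x_1,\ldots,x_n]$ with $K$ a field, and $\mathfrak m=(x_1,\ldots,x_n)$. $C_n$ is the cycle on vertices $x_1,\ldots,x_n$ with edges $\{x_i,x_{i+1}\}$, indices taken modulo $n$. The $t$-path ideal $I_t(C_n)\subset S$ is the ideal generated by the products of the vertices along the $t$-paths of $C_n$ (a $t$-path is a path with $t$ vertices), i.e. by the $n$ monomials $u_j=x_jx_{j+1}\cdots x_{j+t-1}$, $j=1,\ldots,n$ (indices modulo $n$). For an ideal $I=(u_1,\ldots,u_m)$ of $S$, the Rees algebra is $R(I)=S[u_1s,\ldots,u_ms]\subset S[s]$, with $s$ a new variable, and the fiber cone is $F(I)=R(I)/\mathfrak mR(I)$. Since $I_t(C_n)$ is generated in a single degree, $F(I_t(C_n))\cong K[u_1,\ldots,u_n]\subset S$. *)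

theory Defs
  imports
    "HOL-Library.Poly_Mapping"
    "HOL-Library.Extended_Nat"
    "HOL-Computational_Algebra.Polynomial"
    "HOL-Algebra.Generated_Rings"
    "HOL-Algebra.QuotRing"
begin

subsection \<open>Rings carried by a subset of a ring type\<close>

definition ring_on :: "'a::comm_ring_1 set \<Rightarrow> 'a ring"
  where "ring_on A = \<lparr>carrier = A, mult = (*), one = 1, zero = 0, add = (+)\<rparr>"

lemma ring_on_simps [simp]:
  "carrier (ring_on A) = A" "x \<otimes>\<^bsub>ring_on A\<^esub> y = x * y" "\<one>\<^bsub>ring_on A\<^esub> = 1"
  "\<zero>\<^bsub>ring_on A\<^esub> = 0" "x \<oplus>\<^bsub>ring_on A\<^esub> y = x + y"
  by (simp_all add: ring_on_def)

lemma ring_on_cring: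
  fixes A :: "'a::comm_ring_1 set"
  assumes "1 \<in> A" "\<And>x. x \<in> A \<Longrightarrow> - x \<in> A"
    "\<And>x y. x \<in> A \<Longrightarrow> y \<in> A \<Longrightarrow> x + y \<in> A" "\<And>x y. x \<in> A \<Longrightarrow> y \<in> A \<Longrightarrow> x * y \<in> A"
  shows "cring (ring_on A)"
proof (rule cringI)
  have 0: "0 \<in> A" using assms(1) assms(2)[of 1] assms(3)[of 1 "-1"] by simp
  show "abelian_group (ring_on A)"
  proof (rule abelian_groupI)
    fix x assume "x \<in> carrier (ring_on A)"
    then show "\<exists>y\<in>carrier (ring_on A). y \<oplus>\<^bsub>ring_on A\<^esub> x = \<zero>\<^bsub>ring_on A\<^esub>"
      using assms(2) by (auto intro!: bexI[of _ "- x"])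
  qed (use assms 0 in \<open>auto simp: algebra_simps\<close>)
  show "comm_monoid (ring_on A)"
    by (rule comm_monoidI) (use assms in \<open>auto simp: algebra_simps\<close>)
qed (simp add: algebra_simps)

lemma ring_on_a_inv:
  assumes "cring (ring_on A)" "x \<in> A" "- x \<in> A"
  shows "\<ominus>\<^bsub>ring_on A\<^esub> x = - x"
proof -
  interpret cring "ring_on A" by fact
  show ?thesis using minus_equality[of "- x" x] assms(2,3) by simp
qed

subsection \<open>Multivariate polynomials\<close>

text \<open>A monomial is a finitely supported exponent vector indexed by the variables, which are
  natural numbers; the product on \<open>'a mpol\<close> is the convolution product of
  \<^theory>\<open>HOL-Library.Poly_Mapping\<close>.\<close>

type_synonym 'a mpol = "(nat \<Rightarrow>\<^sub>0 nat) \<Rightarrow>\<^sub>0 'a"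

definition Const :: "'a::zero \<Rightarrow> 'a mpol"
  where "Const c = Poly_Mapping.single 0 c"

definition Var :: "nat \<Rightarrow> 'a::zero_neq_one mpol"
  where "Var i = Poly_Mapping.single (Poly_Mapping.single i 1) 1"

definition mpols :: "nat set \<Rightarrow> 'a::zero mpol set"
  where "mpols V = {p. \<forall>m \<in> Poly_Mapping.keys p. Poly_Mapping.keys m \<subseteq> V}"

abbreviation mpol_ring :: "nat set \<Rightarrow> 'a::comm_ring_1 mpol ring"
  where "mpol_ring V \<equiv> ring_on (mpols V)"

lemma mpols_closed:
  fixes p q :: "'a::comm_ring_1 mpol"
  shows Const_in_mpols: "Const (c::'a) \<in> mpols V"
    and Var_in_mpols: "i \<in> V \<Longrightarrow> (Var i :: 'a mpol) \<in> mpols V"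
    and zero_in_mpols: "(0::'a mpol) \<in> mpols V"
    and one_in_mpols: "(1::'a mpol) \<in> mpols V"
    and uminus_in_mpols: "p \<in> mpols V \<Longrightarrow> - p \<in> mpols V"
    and add_in_mpols: "p \<in> mpols V \<Longrightarrow> q \<in> mpols V \<Longrightarrow> p + q \<in> mpols V"
    and mult_in_mpols: "p \<in> mpols V \<Longrightarrow> q \<in> mpols V \<Longrightarrow> p * q \<in> mpols V"
proof -
  show "Const c \<in> mpols V" "(0::'a mpol) \<in> mpols V" "(1::'a mpol) \<in> mpols V"
    by (auto simp: mpols_def Const_def split: if_splits)
  show "i \<in> V \<Longrightarrow> (Var i :: 'a mpol) \<in> mpols V"
    by (auto simp: mpols_def Var_def split: if_splits)
  show "p \<in> mpols V \<Longrightarrow> - p \<in> mpols V"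
    by (auto simp: mpols_def in_keys_iff)
  show "p \<in> mpols V \<Longrightarrow> q \<in> mpols V \<Longrightarrow> p + q \<in> mpols V"
    using keys_add[of p q] by (fastforce simp: mpols_def)
  assume pq: "p \<in> mpols V" "q \<in> mpols V"
  show "p * q \<in> mpols V"
    unfolding mpols_def
  proof (safe)
    fix m i assume "m \<in> Poly_Mapping.keys (p * q)" and i: "i \<in> Poly_Mapping.keys m"
    then obtain a b where "m = a + b" "a \<in> Poly_Mapping.keys p" "b \<in> Poly_Mapping.keys q"
      using keys_mult[of p q] by blast
    then show "i \<in> V"
      using i pq keys_add[of a b] by (fastforce simp: mpols_def)
  qed
qed

lemma mpol_ring_cring: "cring (mpol_ring V :: 'a::comm_ring_1 mpol ring)"
  by (rule ring_on_cring) (auto intro: mpols_closed)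

subsection \<open>Rees algebra and fiber cone\<close>

text \<open>Throughout, \<open>A\<close> is (the carrier of) a subring of a ring type. The new variable \<open>s\<close> is the
  variable of the type of univariate polynomials: \<open>[:a:]\<close> is \<open>a\<close> and \<open>[:0, f:]\<close> is \<open>f s\<close>.\<close>

definition upols :: "'a::comm_ring_1 set \<Rightarrow> 'a poly set"
  where "upols A = {p. \<forall>i. poly.coeff p i \<in> A}"

text \<open>Taking all \<open>f s\<close> with \<open>f \<in> I\<close> makes the algebra depend on the ideal \<open>I\<close> only; by
  \<open>rees_carrier_generators\<close> below, any generating set of \<open>I\<close> yields the same subring.\<close>

definition rees_carrier :: "'a::comm_ring_1 set \<Rightarrow> 'a set \<Rightarrow> 'a poly set"
  where "rees_carrier A I =
    generate_ring (ring_on (upols A)) ((\<lambda>a. [:a:]) ` A \<union> (\<lambda>f. [:0, f:]) ` I)"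

abbreviation rees_algebra :: "'a::comm_ring_1 set \<Rightarrow> 'a set \<Rightarrow> 'a poly ring"
  where "rees_algebra A I \<equiv> ring_on (rees_carrier A I)"

definition extended_ideal :: "'a::comm_ring_1 set \<Rightarrow> 'a set \<Rightarrow> 'a set \<Rightarrow> 'a poly set"
  where "extended_ideal A M I = Idl\<^bsub>rees_algebra A I\<^esub> ((\<lambda>a. [:a:]) ` M)"

definition fiber_cone :: "'a::comm_ring_1 set \<Rightarrow> 'a set \<Rightarrow> 'a set \<Rightarrow> 'a poly set ring"
  where "fiber_cone A M I = rees_algebra A I Quot extended_ideal A M I"

lemma upols_cring:
  assumes "cring (ring_on A)" and "\<And>x. x \<in> A \<Longrightarrow> - x \<in> A"
  shows "cring (ring_on (upols A))"
proof -
  interpret A: cring "ring_on A" by fact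
  have z: "0 \<in> A" and o: "1 \<in> A" using A.zero_closed A.one_closed by simp_all
  have ad: "x + y \<in> A" and mu: "x * y \<in> A" if "x \<in> A" "y \<in> A" for x y
    using A.a_closed[of x y] A.m_closed[of x y] that by simp_all
  have su: "(\<Sum>i\<in>B. f i) \<in> A" if "\<And>i. i \<in> B \<Longrightarrow> f i \<in> A" for B :: "nat set" and f
    using that by (induction B rule: infinite_finite_induct) (auto intro: z ad)
  show ?thesis
    by (rule ring_on_cring)
      (auto simp: upols_def coeff_mult z o ad mu coeff_1 assms(2) intro!: su)
qed

lemma rees_gens_subset:
  assumes "cring (ring_on A)" and "U \<subseteq> A"
  shows "(\<lambda>a. [:a:]) ` A \<union> (\<lambda>f. [:0, f:]) ` U \<subseteq> upols A"
proof -
  interpret A: cring "ring_on A" by fact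
  have "0 \<in> A" using A.zero_closed by simp
  then show ?thesis
    using assms(2) by (auto simp: upols_def coeff_pCons split: nat.split)
qed

lemma rees_cring:
  assumes "cring (ring_on A)" and "\<And>x. x \<in> A \<Longrightarrow> - x \<in> A" and "I \<subseteq> A"
  shows "cring (rees_algebra A I)"
proof -
  interpret U: cring "ring_on (upols A)" using upols_cring assms(1,2) .
  have s: "subring (rees_carrier A I) (ring_on (upols A))"
    unfolding rees_carrier_def
    by (rule U.generate_ring_is_subring) (use rees_gens_subset[OF assms(1,3)] in simp)
  have "\<ominus>\<^bsub>ring_on (upols A)\<^esub> x = - x" if "x \<in> rees_carrier A I" for x
    by (rule ring_on_a_inv[OF U.is_cring])
      (use that subringE(1)[OF s] assms(2) in \<open>auto simp: upols_def\<close>)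
  with subringE[OF s] show ?thesis
    by (intro ring_on_cring) fastforce+
qed

lemma rees_carrier_generators:
  assumes "cring (ring_on A)" and "\<And>x. x \<in> A \<Longrightarrow> - x \<in> A" and "U \<subseteq> A"
  shows "rees_carrier A (Idl\<^bsub>ring_on A\<^esub> U) =
    generate_ring (ring_on (upols A)) ((\<lambda>a. [:a:]) ` A \<union> (\<lambda>u. [:0, u:]) ` U)"
    (is "?L = ?R")
proof
  interpret A: cring "ring_on A" by fact
  interpret P: cring "ring_on (upols A)" using upols_cring assms(1,2) .
  have UI: "U \<subseteq> Idl\<^bsub>ring_on A\<^esub> U" and IA: "Idl\<^bsub>ring_on A\<^esub> U \<subseteq> A"
    using A.genideal_self[of U] A.genideal_ideal[of U] assms(3)
    by (auto dest!: ideal.axioms(1) additive_subgroup.a_subset)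
  have R: "subring ?R (ring_on (upols A))"
    by (rule P.generate_ring_is_subring) (use rees_gens_subset[OF assms(1,3)] in simp)
  show "?R \<subseteq> ?L"
    unfolding rees_carrier_def
    by (rule P.mono_generate_ring) (use UI rees_gens_subset[OF assms(1) IA] in auto)
  have gen: "x \<in> ?R" if "x \<in> (\<lambda>a. [:a:]) ` A \<union> (\<lambda>u. [:0, u:]) ` U" for x
    using that by (rule generate_ring.incl)
  have cl: "x + y \<in> ?R" "x * y \<in> ?R" if "x \<in> ?R" "y \<in> ?R" for x y
    using subringE(6,7)[OF R that] by simp_all
  define J where "J = {f \<in> A. [:0, f:] \<in> ?R}"
  have "0 \<in> A" using A.zero_closed by simp
  have J0: "0 \<in> J" using \<open>0 \<in> A\<close> subringE(2)[OF R] by (simp add: J_def)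
  have Jm: "a * f \<in> J" if "a \<in> A" "f \<in> J" for a f
  proof -
    have "[:a:] * [:0, f:] \<in> ?R" using that gen[of "[:a:]"] by (intro cl) (auto simp: J_def)
    moreover have "[:a:] * [:0, f:] = [:0, a * f:]" by (simp add: mult.commute)
    moreover have "a * f \<in> A" using A.m_closed[of a f] that by (simp add: J_def)
    ultimately show ?thesis unfolding J_def by (simp only: mem_Collect_eq)
  qed
  have Ja: "f + g \<in> J" if "f \<in> J" "g \<in> J" for f g
    using that cl(1)[of "[:0, f:]" "[:0, g:]"] A.a_closed[of f g]
    by (auto simp: J_def)
  have Jn: "- f \<in> J" if "f \<in> J" for f
    using Jm[of "- 1" f] that assms(2)[of 1] A.one_closed by simp
  have "ideal J (ring_on A)"
  proof (rule idealI)
    show "ring (ring_on A)" by (rule A.ring_axioms)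
    show "subgroup J (add_monoid (ring_on A))"
    proof (rule A.add.subgroupI)
      fix a assume "a \<in> J"
      then show "\<ominus>\<^bsub>ring_on A\<^esub> a \<in> J"
        using Jn[of a] ring_on_a_inv[OF assms(1), of a] by (auto simp: J_def)
    qed (use J0 Ja in \<open>auto simp: J_def\<close>)
  next
    fix a x assume "a \<in> J" "x \<in> carrier (ring_on A)"
    then have "x * a \<in> J" by (intro Jm) simp_all
    then show "x \<otimes>\<^bsub>ring_on A\<^esub> a \<in> J" "a \<otimes>\<^bsub>ring_on A\<^esub> x \<in> J"
      by (simp_all add: mult.commute)
  qed
  moreover have "U \<subseteq> J" using assms(3) gen by (auto simp: J_def)
  ultimately have IJ: "Idl\<^bsub>ring_on A\<^esub> U \<subseteq> J" by (rule A.genideal_minimal)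
  show "?L \<subseteq> ?R"
    unfolding rees_carrier_def
    by (rule P.generate_ring_min_subring1)
      (use R IJ gen rees_gens_subset[OF assms(1) IA] in \<open>auto simp: J_def\<close>)
qed

subsection \<open>Krull dimension and polynomial rings\<close>

text \<open>The zero ring, which has no prime ideals, gets dimension \<open>0\<close> here instead of \<open>-\<infinity>\<close>.\<close>

definition krull_dim :: "('a, 'b) ring_scheme \<Rightarrow> enat"
  where "krull_dim R = Sup {enat k | k.
    \<exists>P :: nat \<Rightarrow> 'a set. (\<forall>i \<le> k. primeideal (P i) R) \<and> (\<forall>i < k. P i \<subset> P (Suc i))}"

text \<open>\<open>R\<close>, seen as a \<open>K\<close>-algebra through the structure map \<open>\<iota>\<close>, is isomorphic as a \<open>K\<close>-algebra to
  a polynomial ring in finitely many variables over \<open>K\<close>.\<close>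

definition is_polynomial_ring :: "('k::field \<Rightarrow> 'a) \<Rightarrow> ('a, 'b) ring_scheme \<Rightarrow> bool"
  where "is_polynomial_ring \<iota> R \<longleftrightarrow>
    (\<exists>m. \<exists>\<phi> \<in> ring_iso (mpol_ring {..<m} :: 'k mpol ring) R. \<forall>c. \<phi> (Const c) = \<iota> c)"

subsection \<open>Path ideals of cycles\<close>

text \<open>The vertices \<open>x\<^sub>1, \<dots>, x\<^sub>n\<close> are represented by the residues \<open>0, \<dots>, n - 1\<close>.\<close>

definition cycle_edges :: "nat \<Rightarrow> nat set set"
  where "cycle_edges n = {{i, Suc i mod n} | i. i < n}"

text \<open>A path is given by the list of its vertices; reversed lists describe the same path and yield
  the same monomial.\<close>

definition is_path :: "'v set \<Rightarrow> 'v set set \<Rightarrow> 'v list \<Rightarrow> bool"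
  where "is_path V E vs \<longleftrightarrow> vs \<noteq> [] \<and> set vs \<subseteq> V \<and> distinct vs \<and>
    (\<forall>i. Suc i < length vs \<longrightarrow> {vs ! i, vs ! Suc i} \<in> E)"

definition path_monomials :: "nat \<Rightarrow> nat set \<Rightarrow> nat set set \<Rightarrow> 'a::comm_ring_1 mpol set"
  where "path_monomials t V E = {\<Prod>v\<in>set vs. Var v | vs. is_path V E vs \<and> length vs = t}"

definition path_ideal :: "nat \<Rightarrow> nat set \<Rightarrow> nat set set \<Rightarrow> 'a::comm_ring_1 mpol set"
  where "path_ideal t V E = Idl\<^bsub>mpol_ring V\<^esub> (path_monomials t V E)"

definition cycle_path_ideal :: "nat \<Rightarrow> nat \<Rightarrow> 'a::comm_ring_1 mpol set"
  where "cycle_path_ideal n t = path_ideal t {..<n} (cycle_edges n)"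

definition irrelevant_ideal :: "nat \<Rightarrow> 'a::comm_ring_1 mpol set"
  where "irrelevant_ideal n = Idl\<^bsub>mpol_ring {..<n}\<^esub> (Var ` {..<n})"

definition cycle_fiber_cone :: "nat \<Rightarrow> nat \<Rightarrow> 'a::field mpol poly set ring"
  where "cycle_fiber_cone n t =
    fiber_cone (mpols {..<n}) (irrelevant_ideal n) (cycle_path_ideal n t)"

definition cycle_fiber_const :: "nat \<Rightarrow> nat \<Rightarrow> 'a::field \<Rightarrow> 'a mpol poly set"
  where "cycle_fiber_const n t c =
    extended_ideal (mpols {..<n}) (irrelevant_ideal n) (cycle_path_ideal n t)
      +>\<^bsub>rees_algebra (mpols {..<n}) (cycle_path_ideal n t)\<^esub> [:Const c:]"

lemma cycle_edge_cases:
  assumes "{v, w} \<in> cycle_edges n"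
  shows "w = Suc v mod n \<or> v = Suc w mod n"
  using assms by (auto simp: cycle_edges_def doubleton_eq_iff)

lemma mod_Suc_inj:
  assumes "Suc a mod n = Suc b mod n" "a < n" "b < n"
  shows "a = b"
  using assms by (metis mod_Suc mod_less nat.inject old.nat.distinct(1))

lemma cycle_path_arc:
  assumes "is_path {..<n} (cycle_edges n) vs"
  shows "(\<exists>j<n. \<forall>i<length vs. vs ! i = (j + i) mod n) \<or>
    (\<exists>j<n. \<forall>i<length vs. vs ! i = (j + (length vs - 1 - i)) mod n)"
  using assms
proof (induction vs)
  case Nil
  then show ?case by (simp add: is_path_def)
next
  case (Cons v ws)
  have v: "v < n" using Cons.prems by (simp add: is_path_def)
  show ?case
  proof (cases ws)
    case Nil
    then show ?thesis using v by (intro disjI1 exI[of _ v]) simp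
  next
    case (Cons w us)
    have w: "w < n" and dist: "distinct (v # w # us)"
      using \<open>is_path _ _ (v # ws)\<close> Cons by (auto simp: is_path_def)
    have e: "{v, w} \<in> cycle_edges n"
      using \<open>is_path _ _ (v # ws)\<close> Cons by (auto simp: is_path_def)
    have p: "is_path {..<n} (cycle_edges n) ws"
      unfolding is_path_def
    proof (intro conjI allI impI)
      fix i assume "Suc i < length ws"
      then show "{ws ! i, ws ! Suc i} \<in> cycle_edges n"
        using \<open>is_path _ _ (v # ws)\<close> unfolding is_path_def
        by (metis Suc_less_eq length_Cons nth_Cons_Suc)
    qed (use \<open>is_path _ _ (v # ws)\<close> Cons in \<open>auto simp: is_path_def\<close>)
    consider (f) j where "j < n" "\<And>i. i < length ws \<Longrightarrow> ws ! i = (j + i) mod n"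
      | (b) j where "j < n" "\<And>i. i < length ws \<Longrightarrow> ws ! i = (j + (length ws - 1 - i)) mod n"
      using Cons.IH[OF p] by blast
    then show ?thesis
    proof cases
      case f
      have wj: "w = j" using f(2)[of 0] f(1) Cons by simp
      from cycle_edge_cases[OF e] show ?thesis
      proof
        assume wv: "w = Suc v mod n"
        have "(v # ws) ! i = (v + i) mod n" if "i < length (v # ws)" for i
        proof (cases i)
          case (Suc k)
          then have "(v # ws) ! i = (Suc v mod n + k) mod n" using f(2)[of k] that wj wv by simp
          then show ?thesis using Suc by (simp add: mod_add_left_eq)
        qed (use v in simp)
        then show ?thesis using v by blast
      next
        assume vw: "v = Suc w mod n"
        have "us = []"
        proof (rule ccontr)
          assume "us \<noteq> []"
          then have "us ! 0 = v" using f(2)[of 1] wj vw Cons by simp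
          then show False using dist \<open>us \<noteq> []\<close> by (metis length_greater_0_conv nth_mem distinct.simps(2) list.set_intros(2))
        qed
        then show ?thesis using Cons w vw
          by (intro disjI2 exI[of _ w]) (auto simp: less_Suc_eq)
      qed
    next
      case b
      have wj: "w = (j + (length ws - 1)) mod n" using b(2)[of 0] Cons by simp
      from cycle_edge_cases[OF e] show ?thesis
      proof
        assume vw: "v = Suc w mod n"
        have "(v # ws) ! i = (j + (length (v # ws) - 1 - i)) mod n" if "i < length (v # ws)" for i
        proof (cases i)
          case 0
          have "Suc w mod n = Suc (j + (length ws - 1)) mod n"
            unfolding wj by (rule mod_Suc_eq)
          then show ?thesis using 0 vw Cons by simp
        next
          case (Suc k)
          then show ?thesis using b(2)[of k] that by simp
        qed
        then show ?thesis using b(1) by blast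
      next
        assume wv: "w = Suc v mod n"
        have "us = []"
        proof (rule ccontr)
          assume "us \<noteq> []"
          then obtain u us' where us: "us = u # us'" by (cases us) auto
          have u: "u = (j + length us') mod n" using b(2)[of 1] Cons us by simp
          have "Suc u mod n = Suc (j + length us') mod n" unfolding u by (rule mod_Suc_eq)
          then have "Suc u mod n = w" using wj Cons us by simp
          moreover have "u < n" using v u by simp
          ultimately have "u = v" using wv v mod_Suc_inj by metis
          then show False using dist us by simp
        qed
        then show ?thesis using Cons v w wv
          by (intro disjI1 exI[of _ v]) (auto simp: less_Suc_eq)
      qed
    qed
  qed
qed

text \<open>The right-hand side consists of the monomials \<open>u\<^sub>j = x\<^sub>j x\<^sub>j\<^sub>+\<^sub>1 \<dots> x\<^sub>j\<^sub>+\<^sub>t\<^sub>-\<^sub>1\<close>.\<close>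

lemma cycle_path_monomials:
  assumes "0 < t" "t \<le> n"
  shows "path_monomials t {..<n} (cycle_edges n) =
    {\<Prod>i<t. Var ((j + i) mod n) | j. j < n}"
    (is "?L = ?R")
proof
  have inj: "inj_on (\<lambda>i. (j + i) mod n) {..<t}" for j
  proof (rule inj_onI)
    fix a b assume ab: "a \<in> {..<t}" "b \<in> {..<t}" "(j + a) mod n = (j + b) mod n"
    have *: "b' - a' < n \<and> n dvd b' - a'"
      if "a' \<le> b'" "b' < t" "(j + a') mod n = (j + b') mod n" for a' b'
      using that assms(2) mod_eq_dvd_iff_nat[of "j + a'" "j + b'" n] by auto
    show "a = b"
      using *[of a b] *[of b a] ab nat_dvd_not_less[of "b - a" n] nat_dvd_not_less[of "a - b" n]
      by (cases a b rule: linorder_cases) auto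
  qed
  show "?L \<subseteq> ?R"
  proof
    fix x :: "'a mpol" assume "x \<in> ?L"
    then obtain vs where x: "x = (\<Prod>v\<in>set vs. Var v)" and p: "is_path {..<n} (cycle_edges n) vs"
      and l: "length vs = t" by (auto simp: path_monomials_def)
    have "\<exists>j<n. set vs = (\<lambda>i. (j + i) mod n) ` {..<t}"
      using cycle_path_arc[OF p]
    proof
      assume "\<exists>j<n. \<forall>i<length vs. vs ! i = (j + i) mod n"
      then show ?thesis using l by (force simp: set_conv_nth)
    next
      assume "\<exists>j<n. \<forall>i<length vs. vs ! i = (j + (length vs - 1 - i)) mod n"
      then obtain j where j: "j < n" and vi: "\<And>i. i < t \<Longrightarrow> vs ! i = (j + (t - 1 - i)) mod n"
        using l by auto
      have "set vs = (\<lambda>i. vs ! i) ` {..<t}" using l by (auto simp: set_conv_nth)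
      also have "\<dots> = (\<lambda>i. (j + i) mod n) ` (\<lambda>i. t - 1 - i) ` {..<t}"
        using vi by (auto simp: image_image)
      also have "(\<lambda>i. t - 1 - i) ` {..<t} = {..<t}"
      proof (intro equalityI subsetI)
        fix i assume "i \<in> {..<t}"
        then show "i \<in> (\<lambda>i. t - 1 - i) ` {..<t}" by (intro image_eqI[of _ _ "t - 1 - i"]) auto
      qed (use assms in auto)
      finally show ?thesis using j by blast
    qed
    then obtain j where j: "j < n" and s: "set vs = (\<lambda>i. (j + i) mod n) ` {..<t}" by blast
    have "x = (\<Prod>i<t. Var ((j + i) mod n))"
      unfolding x s by (subst prod.reindex[OF inj]) simp
    with j show "x \<in> ?R" by blast
  qed
  show "?R \<subseteq> ?L"
  proof
    fix x :: "'a mpol" assume "x \<in> ?R"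
    then obtain j where x: "x = (\<Prod>i<t. Var ((j + i) mod n))" and j: "j < n" by blast
    define vs where "vs = map (\<lambda>i. (j + i) mod n) [0..<t]"
    have "is_path {..<n} (cycle_edges n) vs"
      unfolding is_path_def
    proof (intro conjI allI impI)
      show "distinct vs" using inj[of j] by (simp add: vs_def distinct_map lessThan_atLeast0)
      fix i assume i: "Suc i < length vs"
      then have "vs ! i = (j + i) mod n" "vs ! Suc i = Suc ((j + i) mod n) mod n"
        by (simp_all add: vs_def mod_Suc_eq)
      moreover have "(j + i) mod n < n" using j by simp
      ultimately show "{vs ! i, vs ! Suc i} \<in> cycle_edges n"
        unfolding cycle_edges_def by auto
    qed (use assms j in \<open>auto simp: vs_def\<close>)
    moreover have "x = (\<Prod>v\<in>set vs. Var v)"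
    proof -
      have "set vs = (\<lambda>i. (j + i) mod n) ` {..<t}" by (auto simp: vs_def)
      then show ?thesis unfolding x by (simp add: prod.reindex[OF inj])
    qed
    ultimately show "x \<in> ?L"
      unfolding path_monomials_def by (auto simp: vs_def intro!: exI[of _ vs])
  qed
qed

end

theory Submission
  imports Defs "HOL-Number_Theory.Cong"
begin

text \<open>Write \<open>d = gcd n t\<close> and let \<open>e\<^sub>0, \<dots>, e\<^sub>n\<^sub>-\<^sub>1\<close> be the exponent vectors of the monomials \<open>u\<^sub>j\<close>:
\<open>e\<^sub>j\<close> is the indicator of the cyclic window of length \<open>t\<close> that starts at \<open>j\<close>. Let \<open>\<Gamma>\<close> be the monoid
that they generate. In \<open>s\<close>-degree \<open>k\<close> the exponents of the Rees algebra are the sums of \<open>k\<close> windows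
plus arbitrary exponents, so their total degree is at least \<open>k t\<close>, and the ideal extended from the
maximal ideal consists of the elements whose exponents all lie strictly above this bound. Keeping
only the exponents of minimal degree therefore identifies the fiber cone with the monoid algebra
\<open>K[\<Gamma>]\<close> (\<open>fiber_cone_iso\<close>), and the theorem becomes a statement about \<open>\<Gamma>\<close>.

The dimension is at most \<open>n - d + 1\<close> because \<open>\<Gamma>\<close> grows slowly. A window of length \<open>t\<close> meets every
residue class modulo \<open>d\<close> in \<open>t / d\<close> places, so all elements of \<open>\<Gamma>\<close> have the same coordinate sum on
each of the \<open>d\<close> classes; hence the \<open>n - d + 1\<close> coordinates \<open>0, d, d + 1, \<dots>, n - 1\<close> determine them
(\<open>window_sum_coordinates_inj\<close>). On the other hand, elements picked from the successive steps of a
strict chain of primes are algebraically independent (\<open>prime_chain_steps_independent\<close>), and a long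
chain would yield more monomials in them than \<open>\<Gamma>\<close> has room for (\<open>krull_dim_monoid_algebra_le\<close>).

The dimension is at least \<open>n - d + 1\<close> because \<open>\<Gamma>\<close> has a long chain of faces, each of which defines a
prime. The coefficients of a linear relation between the windows are periodic with periods \<open>t\<close> and
\<open>n\<close>, hence with period \<open>d\<close>, and they add up to zero by comparing total degrees. So a relation whose
first \<open>d\<close> coefficients are nonnegative is trivial (\<open>window_sum_determined_by_initial_order\<close>). It
follows that the sums which avoid the first \<open>r\<close> windows form a face as soon as \<open>r \<ge> d\<close>, and
\<open>\<Gamma>\<close> together with these faces for \<open>r = d, \<dots>, n\<close> is a chain with \<open>n - d + 1\<close> steps.

If \<open>d = 1\<close>, the same fact shows that there are no relations at all: \<open>\<Gamma>\<close> is free on the \<open>n\<close> windows and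
\<open>K[\<Gamma>]\<close> is a polynomial ring. Conversely, let \<open>K[\<Gamma>]\<close> be a polynomial ring in \<open>m\<close> variables. Then \<open>m\<close>
is at most its dimension \<open>n - d + 1\<close>. Moreover \<open>n \<le> m\<close>: the coefficient of an indecomposable exponent
\<open>e\<^sub>j\<close> obeys the Leibniz rule at the origin, so a linear combination of these \<open>n\<close> functionals is
determined by its values on the images of the \<open>m\<close> variables, while the functionals are linearly
independent (\<open>indecomposables_le_variables\<close>). Hence \<open>n \<le> n - d + 1\<close> and \<open>d = 1\<close>.\<close>

section \<open>Homogeneous linear systems\<close>

text \<open>Gaussian elimination, one equation per step of the induction: an equation that involves some unknown
\<open>e0\<close> is solved for it, and otherwise it holds automatically.\<close>

lemma homogeneous_system_nontrivial:
  fixes f :: "'e \<Rightarrow> 'b \<Rightarrow> 'k::field"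
  assumes "finite B" and "finite E" and "card B < card E"
  shows "\<exists>c. (\<exists>e\<in>E. c e \<noteq> 0) \<and> (\<forall>b\<in>B. (\<Sum>e\<in>E. c e * f e b) = 0)"
  using assms
proof (induction B arbitrary: E f rule: finite_induct)
  case empty
  then obtain e where "e \<in> E" by fastforce
  then show ?case by (intro exI[of _ "\<lambda>_. 1"]) auto
next
  case (insert b B)
  show ?case
  proof (cases "\<forall>e\<in>E. f e b = 0")
    case True
    have "card B < card E" using insert by simp
    from insert.IH[OF \<open>finite E\<close> this, of f] obtain c
      where "\<exists>e\<in>E. c e \<noteq> 0" "\<forall>x\<in>B. (\<Sum>e\<in>E. c e * f e x) = 0" by blast
    then show ?thesis using True by (intro exI[of _ c]) auto
  next
    case False
    then obtain e0 where e0: "e0 \<in> E" "f e0 b \<noteq> 0" by blast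
    define E' where "E' = E - {e0}"
    have E: "E = insert e0 E'" "e0 \<notin> E'" "finite E'" using e0 insert.prems by (auto simp: E'_def)
    have "card B < card E'" using insert E by simp
    from insert.IH[OF E(3) this, of "\<lambda>e x. f e x - f e b / f e0 b * f e0 x"] obtain c
      where c: "\<exists>e\<in>E'. c e \<noteq> 0"
        "\<And>x. x \<in> B \<Longrightarrow> (\<Sum>e\<in>E'. c e * (f e x - f e b / f e0 b * f e0 x)) = 0" by blast
    \<comment> \<open>The value at \<open>e0\<close> is chosen so as to satisfy the equation \<open>b\<close>.\<close>
    define c' where "c' = c(e0 := - (\<Sum>e\<in>E'. c e * f e b) / f e0 b)"
    have *: "(\<Sum>e\<in>E. c' e * f e x) = (\<Sum>e\<in>E'. c e * (f e x - f e b / f e0 b * f e0 x))" for x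
    proof -
      have "(\<Sum>e\<in>E. c' e * f e x)
          = - (\<Sum>e\<in>E'. c e * f e b) / f e0 b * f e0 x + (\<Sum>e\<in>E'. c' e * f e x)"
        using E by (simp add: c'_def)
      also have "(\<Sum>e\<in>E'. c' e * f e x) = (\<Sum>e\<in>E'. c e * f e x)"
        by (rule sum.cong) (use E in \<open>auto simp: c'_def\<close>)
      finally show ?thesis
        by (simp add: right_diff_distrib sum_subtractf sum_distrib_right sum_divide_distrib
            mult.assoc)
    qed
    have "\<exists>e\<in>E. c' e \<noteq> 0" using c(1) E by (auto simp: c'_def)
    moreover have "\<forall>x\<in>insert b B. (\<Sum>e\<in>E. c' e * f e x) = 0"
      unfolding * using c(2) e0 by auto
    ultimately show ?thesis by blast
  qed
qed

section \<open>Krull dimension and ring homomorphisms\<close>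

text \<open>Preimages of primes are prime, and surjectivity keeps the inclusions of a chain strict.\<close>

lemma krull_dim_surj:
  assumes "ring_hom_ring R S h" and R: "cring R" and surj: "h ` carrier R = carrier S"
  shows "krull_dim S \<le> krull_dim R"
  unfolding krull_dim_def
proof (rule Sup_subset_mono, safe)
  fix k P
  assume P: "\<forall>i\<le>k. primeideal (P i) S" and strict: "\<forall>i<k. P i \<subset> P (Suc i)"
  interpret ring_hom_ring R S h by fact
  define Q where "Q i = {r \<in> carrier R. h r \<in> P i}" for i
  have "primeideal (Q i) R" if "i \<le> k" for i
    unfolding Q_def using primeideal_vimage[OF R] P that by blast
  moreover have "Q i \<subset> Q (Suc i)" if i: "i < k" for i
  proof -
    obtain y where y: "y \<in> P (Suc i)" "y \<notin> P i" using strict i by blast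
    have "P (Suc i) \<subseteq> carrier S"
      using P i by (meson Suc_leI additive_subgroup.a_subset ideal_def primeideal.axioms(1))
    then have "y \<in> h ` carrier R" using y surj by blast
    then obtain x where "x \<in> carrier R" "h x = y" by blast
    then have "x \<in> Q (Suc i)" "x \<notin> Q i" using y by (auto simp: Q_def)
    moreover have "Q i \<subseteq> Q (Suc i)" using strict i by (auto simp: Q_def)
    ultimately show ?thesis by blast
  qed
  ultimately show "\<exists>k'. enat k = enat k' \<and>
      (\<exists>P. (\<forall>i\<le>k'. primeideal (P i) R) \<and> (\<forall>i<k'. P i \<subset> P (Suc i)))"
    by (intro exI[of _ k] conjI exI[of _ Q]) auto
qed

lemma krull_dim_ring_iso:
  assumes "h \<in> ring_iso R S" and "cring R" and "cring S"
  shows "krull_dim R = krull_dim S"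
proof (rule antisym)
  have R: "ring R" and S: "ring S" using assms(2,3) by (auto simp: cring_def)
  have *: "krull_dim S' \<le> krull_dim R'"
    if "g \<in> ring_iso R' S'" "cring R'" "ring S'"
    for g :: "'e \<Rightarrow> 'f" and R' :: "('e, 'g) ring_scheme" and S' :: "('f, 'h) ring_scheme"
  proof (rule krull_dim_surj)
    show "ring_hom_ring R' S' g"
      using that by (intro ring_hom_ringI2) (auto simp: ring_iso_def cring_def)
    show "g ` carrier R' = carrier S'" using that by (auto simp: ring_iso_def bij_betw_def)
  qed fact
  show "krull_dim S \<le> krull_dim R" using *[OF assms(1,2) S] .
  show "krull_dim R \<le> krull_dim S" using *[OF ring_iso_set_sym[OF R assms(1)] assms(3) R] .
qed

lemma is_polynomial_ring_iso:
  assumes \<psi>: "\<psi> \<in> ring_iso R S" and R: "ring R"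
    and \<iota>: "\<And>c. \<iota> c \<in> carrier R" "\<And>c. \<psi> (\<iota> c) = \<kappa> c"
  shows "is_polynomial_ring \<iota> R \<longleftrightarrow> is_polynomial_ring \<kappa> S"
proof
  assume "is_polynomial_ring \<iota> R"
  then obtain m \<phi> where \<phi>: "\<phi> \<in> ring_iso (mpol_ring {..<m}) R" "\<And>c. \<phi> (Const c) = \<iota> c"
    by (auto simp: is_polynomial_ring_def)
  have "\<psi> \<circ> \<phi> \<in> ring_iso (mpol_ring {..<m}) S" using ring_iso_set_trans[OF \<phi>(1) \<psi>] .
  moreover have "\<forall>c. (\<psi> \<circ> \<phi>) (Const c) = \<kappa> c" using \<phi>(2) \<iota>(2) by simp
  ultimately show "is_polynomial_ring \<kappa> S" unfolding is_polynomial_ring_def by blast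
next
  let ?\<psi>' = "inv_into (carrier R) \<psi>"
  assume "is_polynomial_ring \<kappa> S"
  then obtain m \<phi> where \<phi>: "\<phi> \<in> ring_iso (mpol_ring {..<m}) S" "\<And>c. \<phi> (Const c) = \<kappa> c"
    by (auto simp: is_polynomial_ring_def)
  have "?\<psi>' \<circ> \<phi> \<in> ring_iso (mpol_ring {..<m}) R"
    using ring_iso_set_trans[OF \<phi>(1) ring_iso_set_sym[OF R \<psi>]] .
  moreover have "?\<psi>' (\<kappa> c) = \<iota> c" for c
    using \<psi> \<iota>[of c] by (intro inv_into_f_eq) (auto simp: ring_iso_def bij_betw_def)
  then have "\<forall>c. (?\<psi>' \<circ> \<phi>) (Const c) = \<iota> c" using \<phi>(2) by simp
  ultimately show "is_polynomial_ring \<iota> R" unfolding is_polynomial_ring_def by blast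
qed

section \<open>Subrings and their ideals\<close>

lemma cring_on_closed:
  fixes A :: "'a::comm_ring_1 set"
  assumes "cring (ring_on A)"
  shows one_in_cring_on: "1 \<in> A"
    and add_in_cring_on: "x \<in> A \<Longrightarrow> y \<in> A \<Longrightarrow> x + y \<in> A"
    and mult_in_cring_on: "x \<in> A \<Longrightarrow> y \<in> A \<Longrightarrow> x * y \<in> A"
    and uminus_in_cring_on: "x \<in> A \<Longrightarrow> - x \<in> A"
    and power_in_cring_on: "x \<in> A \<Longrightarrow> x ^ k \<in> A"
    and sum_in_cring_on: "(\<And>i. i \<in> I \<Longrightarrow> f i \<in> A) \<Longrightarrow> sum f I \<in> A"
    and prod_in_cring_on: "(\<And>i. i \<in> I \<Longrightarrow> f i \<in> A) \<Longrightarrow> prod f I \<in> A"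
proof -
  interpret cring "ring_on A" by fact
  have 0: "0 \<in> A" using zero_closed by simp
  show 1: "1 \<in> A" using one_closed by simp
  show add: "x \<in> A \<Longrightarrow> y \<in> A \<Longrightarrow> x + y \<in> A" and mult: "x \<in> A \<Longrightarrow> y \<in> A \<Longrightarrow> x * y \<in> A" for x y
    using a_closed[of x y] m_closed[of x y] by simp_all
  show "- x \<in> A" if "x \<in> A"
  proof -
    have "\<ominus>\<^bsub>ring_on A\<^esub> x \<in> A" "\<ominus>\<^bsub>ring_on A\<^esub> x + x = 0"
      using that a_inv_closed[of x] l_neg[of x] by simp_all
    then show ?thesis by (simp add: eq_neg_iff_add_eq_0[symmetric])
  qed
  show "x \<in> A \<Longrightarrow> x ^ k \<in> A" by (induction k) (auto intro: 1 mult)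
  show "(\<And>i. i \<in> I \<Longrightarrow> f i \<in> A) \<Longrightarrow> sum f I \<in> A"
    by (induction I rule: infinite_finite_induct) (auto intro: 0 add)
  show "(\<And>i. i \<in> I \<Longrightarrow> f i \<in> A) \<Longrightarrow> prod f I \<in> A"
    by (induction I rule: infinite_finite_induct) (auto intro: 1 mult)
qed

lemma ideal_on_closed:
  fixes A :: "'a::comm_ring_1 set"
  assumes "ideal J (ring_on A)"
  shows ideal_on_subset: "J \<subseteq> A"
    and zero_in_ideal_on: "0 \<in> J"
    and add_in_ideal_on: "x \<in> J \<Longrightarrow> y \<in> J \<Longrightarrow> x + y \<in> J"
    and mult_in_ideal_on: "x \<in> J \<Longrightarrow> y \<in> A \<Longrightarrow> x * y \<in> J"
    and sum_in_ideal_on: "(\<And>i. i \<in> I \<Longrightarrow> f i \<in> J) \<Longrightarrow> sum f I \<in> J"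
proof -
  interpret ideal J "ring_on A" by fact
  show "J \<subseteq> A" using a_subset by simp
  show "x \<in> J \<Longrightarrow> y \<in> A \<Longrightarrow> x * y \<in> J" using I_r_closed[of x y] by simp
  show 0: "0 \<in> J" using additive_subgroup.zero_closed[OF additive_subgroup_axioms] by simp
  show add: "x + y \<in> J" if "x \<in> J" "y \<in> J" for x y
    using additive_subgroup.a_closed[OF additive_subgroup_axioms that] by simp
  show "(\<And>i. i \<in> I \<Longrightarrow> f i \<in> J) \<Longrightarrow> sum f I \<in> J"
    by (induction I rule: infinite_finite_induct) (auto intro: 0 add)
qed

lemma primeideal_on_closed:
  fixes A :: "'a::comm_ring_1 set"
  assumes "primeideal P (ring_on A)"
  shows ideal_of_primeideal_on: "ideal P (ring_on A)"
    and cring_of_primeideal_on: "cring (ring_on A)"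
    and diff_in_primeideal_on: "x \<in> P \<Longrightarrow> y \<in> P \<Longrightarrow> x - y \<in> P"
    and primeideal_on_prime: "x \<in> A \<Longrightarrow> y \<in> A \<Longrightarrow> x * y \<in> P \<Longrightarrow> x \<notin> P \<Longrightarrow> y \<in> P"
    and one_notin_primeideal_on: "1 \<notin> P"
    and power_notin_primeideal_on: "x \<in> A \<Longrightarrow> x \<notin> P \<Longrightarrow> x ^ k \<notin> P"
proof -
  interpret primeideal P "ring_on A" by fact
  show id: "ideal P (ring_on A)" by (rule is_ideal)
  show cr: "cring (ring_on A)" by (rule is_cring)
  show prime: "x \<in> A \<Longrightarrow> y \<in> A \<Longrightarrow> x * y \<in> P \<Longrightarrow> x \<notin> P \<Longrightarrow> y \<in> P" for x y
    using I_prime[of x y] by auto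
  show "x - y \<in> P" if "x \<in> P" "y \<in> P"
  proof -
    have "y * (- 1) \<in> P"
      using that cr by (intro mult_in_ideal_on[OF id] uminus_in_cring_on one_in_cring_on)
    then show ?thesis using add_in_ideal_on[OF id \<open>x \<in> P\<close>, of "- y"] by simp
  qed
  show 1: "1 \<notin> P" using one_imp_carrier I_notcarr by auto
  show "x ^ k \<notin> P" if "x \<in> A" "x \<notin> P"
  proof (induction k)
    case (Suc k)
    then show ?case using prime[of x "x ^ k"] that power_in_cring_on[OF cr] by auto
  qed (simp add: 1)
qed

section \<open>Monoid algebras\<close>

lemma poly_mapping_sum_single:
  "p = (\<Sum>m\<in>Poly_Mapping.keys p. Poly_Mapping.single m (Poly_Mapping.lookup p m))"
  by (rule poly_mapping_eqI) (simp add: lookup_sum lookup_single when_def in_keys_iff)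

lemma mult_eq_sum_single:
  fixes p q :: "'a::comm_ring_1 mpol"
  shows "p * q = (\<Sum>a\<in>Poly_Mapping.keys p. \<Sum>b\<in>Poly_Mapping.keys q.
    Poly_Mapping.single (a + b) (Poly_Mapping.lookup p a * Poly_Mapping.lookup q b))"
proof -
  have "p * q = (\<Sum>a\<in>Poly_Mapping.keys p. Poly_Mapping.single a (Poly_Mapping.lookup p a))
      * (\<Sum>b\<in>Poly_Mapping.keys q. Poly_Mapping.single b (Poly_Mapping.lookup q b))"
    by (simp only: poly_mapping_sum_single[symmetric])
  then show ?thesis by (simp add: sum_product mult_single)
qed

lemma lookup_Const_mult:
  "Poly_Mapping.lookup (Const c * p) m = c * Poly_Mapping.lookup p (m::nat \<Rightarrow>\<^sub>0 nat)"
  for c :: "'a::comm_ring_1"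
  unfolding Const_def mult_map_scale_conv_mult[symmetric] by transfer (simp add: when_def)

definition exponent_monoid :: "(nat \<Rightarrow>\<^sub>0 nat) set \<Rightarrow> bool"
  where "exponent_monoid G \<longleftrightarrow> 0 \<in> G \<and> (\<forall>a\<in>G. \<forall>b\<in>G. a + b \<in> G)"

definition monoid_algebra :: "(nat \<Rightarrow>\<^sub>0 nat) set \<Rightarrow> 'a::zero mpol set"
  where "monoid_algebra G = {p. Poly_Mapping.keys p \<subseteq> G}"

lemma mpols_eq_monoid_algebra: "mpols V = monoid_algebra {m. Poly_Mapping.keys m \<subseteq> V}"
  by (auto simp: mpols_def monoid_algebra_def)

lemma exponent_monoid_keys_subset: "exponent_monoid {m. Poly_Mapping.keys m \<subseteq> V}"
  using keys_add by (fastforce simp: exponent_monoid_def)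

lemma monoid_algebra_closed:
  fixes p q :: "'a::comm_ring_1 mpol"
  shows zero_in_monoid_algebra: "(0::'a mpol) \<in> monoid_algebra G"
    and uminus_in_monoid_algebra: "p \<in> monoid_algebra G \<Longrightarrow> - p \<in> monoid_algebra G"
    and add_in_monoid_algebra:
      "p \<in> monoid_algebra G \<Longrightarrow> q \<in> monoid_algebra G \<Longrightarrow> p + q \<in> monoid_algebra G"
    and single_in_monoid_algebra: "m \<in> G \<Longrightarrow> Poly_Mapping.single m (c::'a) \<in> monoid_algebra G"
    and sum_in_monoid_algebra:
      "(\<And>i. i \<in> I \<Longrightarrow> f i \<in> monoid_algebra G) \<Longrightarrow> (\<Sum>i\<in>I. f i :: 'a mpol) \<in> monoid_algebra G"
proof -
  show 0: "(0::'a mpol) \<in> monoid_algebra G" by (simp add: monoid_algebra_def)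
  show "p \<in> monoid_algebra G \<Longrightarrow> - p \<in> monoid_algebra G"
    by (auto simp: monoid_algebra_def in_keys_iff)
  show add: "p \<in> monoid_algebra G \<Longrightarrow> q \<in> monoid_algebra G \<Longrightarrow> p + q \<in> monoid_algebra G"
    for p q :: "'a mpol"
    using keys_add[of p q] by (auto simp: monoid_algebra_def)
  show "m \<in> G \<Longrightarrow> Poly_Mapping.single m (c::'a) \<in> monoid_algebra G"
    by (simp add: monoid_algebra_def)
  show "(\<And>i. i \<in> I \<Longrightarrow> f i \<in> monoid_algebra G) \<Longrightarrow> (\<Sum>i\<in>I. f i :: 'a mpol) \<in> monoid_algebra G"
    by (induction I rule: infinite_finite_induct) (auto intro: 0 add)
qed

lemma monoid_algebra_mult_closed:
  fixes p q :: "'a::comm_ring_1 mpol"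
  assumes "exponent_monoid G"
  shows one_in_monoid_algebra: "(1::'a mpol) \<in> monoid_algebra G"
    and Const_in_monoid_algebra: "Const (c::'a) \<in> monoid_algebra G"
    and mult_in_monoid_algebra:
      "p \<in> monoid_algebra G \<Longrightarrow> q \<in> monoid_algebra G \<Longrightarrow> p * q \<in> monoid_algebra G"
proof -
  have 0: "0 \<in> G" and ad: "\<And>a b. a \<in> G \<Longrightarrow> b \<in> G \<Longrightarrow> a + b \<in> G"
    using assms by (auto simp: exponent_monoid_def)
  show "(1::'a mpol) \<in> monoid_algebra G" by (simp add: monoid_algebra_def 0)
  show "Const c \<in> monoid_algebra G" by (simp add: monoid_algebra_def Const_def 0)
  show "p \<in> monoid_algebra G \<Longrightarrow> q \<in> monoid_algebra G \<Longrightarrow> p * q \<in> monoid_algebra G"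
    using keys_mult[of p q] ad unfolding monoid_algebra_def by blast
qed

lemma monoid_algebra_cring:
  "exponent_monoid G \<Longrightarrow> cring (ring_on (monoid_algebra G :: 'a::comm_ring_1 mpol set))"
  by (rule ring_on_cring)
    (auto intro: one_in_monoid_algebra uminus_in_monoid_algebra add_in_monoid_algebra
      mult_in_monoid_algebra)

subsection \<open>Total degree\<close>

definition tdeg :: "(nat \<Rightarrow>\<^sub>0 nat) \<Rightarrow> nat"
  where "tdeg m = (\<Sum>i\<in>Poly_Mapping.keys m. Poly_Mapping.lookup m i)"

lemma tdeg_0 [simp]: "tdeg 0 = 0"
  by (simp add: tdeg_def)

lemma tdeg_single [simp]: "tdeg (Poly_Mapping.single i k) = k"
  by (simp add: tdeg_def)

lemma tdeg_add: "tdeg (a + b) = tdeg a + tdeg b"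
  unfolding tdeg_def by (rule setsum_keys_plus_distrib) auto

lemma tdeg_sum: "tdeg (\<Sum>i\<in>I. f i) = (\<Sum>i\<in>I. tdeg (f i))"
  by (induction I rule: infinite_finite_induct) (auto simp: tdeg_add)

lemma tdeg_eq_0_iff [simp]: "tdeg m = 0 \<longleftrightarrow> m = 0"
  by (auto simp: tdeg_def in_keys_iff intro: poly_mapping_eqI)

lemma exponent_add_eq_0_iff: "a + b = 0 \<longleftrightarrow> a = 0 \<and> b = (0 :: nat \<Rightarrow>\<^sub>0 nat)"
  by (metis add_is_0 tdeg_add tdeg_eq_0_iff)

lemma keys_exponent_add:
  "Poly_Mapping.keys (a + b) = Poly_Mapping.keys a \<union> Poly_Mapping.keys (b :: nat \<Rightarrow>\<^sub>0 nat)"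
  by (auto simp: in_keys_iff lookup_add)

lemma exponent_split_variable:
  assumes "i \<in> Poly_Mapping.keys (m :: nat \<Rightarrow>\<^sub>0 nat)"
  obtains m' where "m = Poly_Mapping.single i 1 + m'"
proof
  show "m = Poly_Mapping.single i 1 + (m - Poly_Mapping.single i 1)"
    using assms
    by (intro poly_mapping_eqI)
      (auto simp: lookup_add lookup_minus lookup_single when_def in_keys_iff)
qed

subsection \<open>Restriction to a set of exponents\<close>

lift_definition restrict_keys :: "'m set \<Rightarrow> ('m \<Rightarrow>\<^sub>0 'a) \<Rightarrow> 'm \<Rightarrow>\<^sub>0 'a::zero"
  is "\<lambda>F p m. p m when m \<in> F"
  by (erule rev_finite_subset) auto

lemma lookup_restrict_keys [simp]:
  "Poly_Mapping.lookup (restrict_keys F p) m = (Poly_Mapping.lookup p m when m \<in> F)"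
  by transfer simp

lemma restrict_keys_0 [simp]: "restrict_keys F 0 = 0"
  by (rule poly_mapping_eqI) simp

lemma restrict_keys_add: "restrict_keys F (p + q) = restrict_keys F p + restrict_keys F q"
  by (rule poly_mapping_eqI) (simp add: lookup_add when_add_distrib)

lemma restrict_keys_sum: "restrict_keys F (\<Sum>i\<in>I. f i) = (\<Sum>i\<in>I. restrict_keys F (f i))"
  by (induction I rule: infinite_finite_induct) (auto simp: restrict_keys_add)

lemma restrict_keys_single:
  "restrict_keys F (Poly_Mapping.single m c) = (if m \<in> F then Poly_Mapping.single m c else 0)"
  by (rule poly_mapping_eqI) (auto simp: lookup_single when_def)

lemma keys_restrict_keys: "Poly_Mapping.keys (restrict_keys F p) = Poly_Mapping.keys p \<inter> F"
  by (auto simp: in_keys_iff)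

lemma restrict_keys_eq_0_iff: "restrict_keys F p = 0 \<longleftrightarrow> Poly_Mapping.keys p \<inter> F = {}"
  using keys_restrict_keys[of F p] by (metis keys_zero keys_eq_empty)

text \<open>Selecting monomials is multiplicative whenever a product of two monomials is selected exactly if both
factors are. The three selections may differ. With \<open>F = F1 = F2\<close> a face, this turns faces into ring
homomorphisms; applied to the exponents of least total degree, it shows that passing to the lowest
part of a Rees algebra is multiplicative.\<close>

lemma restrict_keys_mult:
  fixes p q :: "'a::comm_ring_1 mpol"
  assumes "\<And>a b. a \<in> Poly_Mapping.keys p \<Longrightarrow> b \<in> Poly_Mapping.keys q \<Longrightarrow>
    a + b \<in> F \<longleftrightarrow> a \<in> F1 \<and> b \<in> F2"
  shows "restrict_keys F (p * q) = restrict_keys F1 p * restrict_keys F2 q"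
proof -
  let ?s = "\<lambda>p m. Poly_Mapping.single m (Poly_Mapping.lookup p m)"
  have expand: "restrict_keys H r = (\<Sum>m\<in>Poly_Mapping.keys r. restrict_keys H (?s r m))"
    for H and r :: "'a mpol"
    by (subst (1) poly_mapping_sum_single[of r]) (rule restrict_keys_sum)
  have "restrict_keys F (p * q) = (\<Sum>a\<in>Poly_Mapping.keys p. \<Sum>b\<in>Poly_Mapping.keys q.
      restrict_keys F (Poly_Mapping.single (a + b) (Poly_Mapping.lookup p a * Poly_Mapping.lookup q b)))"
    by (simp only: mult_eq_sum_single[of p q] restrict_keys_sum)
  also have "\<dots> = (\<Sum>a\<in>Poly_Mapping.keys p. \<Sum>b\<in>Poly_Mapping.keys q.
      restrict_keys F1 (?s p a) * restrict_keys F2 (?s q b))"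
    by (intro sum.cong refl) (use assms in \<open>auto simp: mult_single restrict_keys_single\<close>)
  also have "\<dots> = restrict_keys F1 p * restrict_keys F2 q"
    by (simp only: expand[of F1 p] expand[of F2 q] sum_product)
  finally show ?thesis .
qed

subsection \<open>Faces and primes\<close>

definition face :: "(nat \<Rightarrow>\<^sub>0 nat) set \<Rightarrow> (nat \<Rightarrow>\<^sub>0 nat) set \<Rightarrow> bool"
  where "face G F \<longleftrightarrow> F \<subseteq> G \<and> 0 \<in> F \<and> (\<forall>a\<in>G. \<forall>b\<in>G. a + b \<in> F \<longleftrightarrow> a \<in> F \<and> b \<in> F)"

lemma face_zero: "exponent_monoid G \<Longrightarrow> face G {0}"
  by (auto simp: face_def exponent_monoid_def exponent_add_eq_0_iff)

lemma ring_on_UNIV_domain: "domain (ring_on (UNIV :: 'a::idom set))"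
proof -
  interpret cring "ring_on (UNIV :: 'a set)" by (rule ring_on_cring) auto
  show ?thesis by unfold_locales auto
qed

text \<open>Forgetting the monomials outside a face is a ring homomorphism into a domain. Its kernel is the prime
ideal that belongs to the face.\<close>

lemma face_hom:
  assumes "exponent_monoid G" and "face G F"
  shows "ring_hom_ring (ring_on (monoid_algebra G :: 'a::idom mpol set)) (ring_on UNIV) (restrict_keys F)"
proof (rule ring_hom_ringI)
  show "ring (ring_on (monoid_algebra G :: 'a mpol set))"
    using monoid_algebra_cring[OF assms(1)] by (rule cring.axioms)
  show "ring (ring_on (UNIV :: 'a mpol set))"
    by (intro cring.axioms(1) domain.axioms(1) ring_on_UNIV_domain)
  fix p q :: "'a mpol"
  assume "p \<in> carrier (ring_on (monoid_algebra G))" "q \<in> carrier (ring_on (monoid_algebra G))"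
  then have "Poly_Mapping.keys p \<subseteq> G" "Poly_Mapping.keys q \<subseteq> G" by (auto simp: monoid_algebra_def)
  then have "restrict_keys F (p * q) = restrict_keys F p * restrict_keys F q"
    using assms(2) unfolding face_def by (intro restrict_keys_mult) blast
  then show "restrict_keys F (p \<otimes>\<^bsub>ring_on (monoid_algebra G)\<^esub> q)
      = restrict_keys F p \<otimes>\<^bsub>ring_on UNIV\<^esub> restrict_keys F q" by simp
next
  show "restrict_keys F \<one>\<^bsub>ring_on (monoid_algebra G)\<^esub> = (\<one>\<^bsub>ring_on UNIV\<^esub> :: 'a mpol)"
    using assms(2) restrict_keys_single[of F 0 "1::'a"] by (simp add: face_def)
qed (auto simp: restrict_keys_add)

lemma face_primeideal:
  assumes "exponent_monoid G" and "face G F"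
  shows "primeideal {p \<in> monoid_algebra G. Poly_Mapping.keys p \<inter> F = {}}
    (ring_on (monoid_algebra G :: 'a::idom mpol set))"
proof -
  interpret ring_hom_ring "ring_on (monoid_algebra G :: 'a mpol set)" "ring_on UNIV" "restrict_keys F"
    by (rule face_hom[OF assms])
  interpret D: domain "ring_on (UNIV :: 'a mpol set)" by (rule ring_on_UNIV_domain)
  have "primeideal {0} (ring_on (UNIV :: 'a mpol set))"
    using D.zeroprimeideal by simp
  from primeideal_vimage[OF monoid_algebra_cring[OF assms(1)] this] show ?thesis
    by (simp add: restrict_keys_eq_0_iff)
qed

lemma face_chain_le_krull_dim:
  assumes G: "exponent_monoid G" and F: "\<And>i. i \<le> k \<Longrightarrow> face G (F i)"
    and strict: "\<And>i. i < k \<Longrightarrow> F (Suc i) \<subset> F i"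
  shows "enat k \<le> krull_dim (ring_on (monoid_algebra G :: 'a::idom mpol set))"
  unfolding krull_dim_def
proof (rule Sup_upper, intro CollectI exI conjI allI impI)
  let ?P = "\<lambda>i. {p \<in> monoid_algebra G :: 'a mpol set. Poly_Mapping.keys p \<inter> F i = {}}"
  show "enat k = enat k" ..
  show "primeideal (?P i) (ring_on (monoid_algebra G))" if "i \<le> k" for i
    using that G F by (intro face_primeideal)
  show "?P i \<subset> ?P (Suc i)" if i: "i < k" for i
  proof -
    obtain m where m: "m \<in> F i" "m \<notin> F (Suc i)" using strict i by blast
    then have "m \<in> G" using F[of i] i by (auto simp: face_def)
    then have "Poly_Mapping.single m 1 \<in> ?P (Suc i)" "Poly_Mapping.single m 1 \<notin> ?P i"
      using m by (auto simp: monoid_algebra_def)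
    moreover have "?P i \<subseteq> ?P (Suc i)" using strict[OF i] by blast
    ultimately show ?thesis by blast
  qed
qed

subsection \<open>Isomorphisms of monoids\<close>

definition push_exponents :: "((nat \<Rightarrow>\<^sub>0 nat) \<Rightarrow> (nat \<Rightarrow>\<^sub>0 nat)) \<Rightarrow> 'a::comm_ring_1 mpol \<Rightarrow> 'a mpol"
  where "push_exponents \<omega> p = (\<Sum>m\<in>Poly_Mapping.keys p. Poly_Mapping.single (\<omega> m) (Poly_Mapping.lookup p m))"

lemma push_exponents_add: "push_exponents \<omega> (p + q) = push_exponents \<omega> p + push_exponents \<omega> q"
  unfolding push_exponents_def by (rule setsum_keys_plus_distrib) (auto simp: single_add)

lemma push_exponents_sum: "push_exponents \<omega> (\<Sum>i\<in>I. f i) = (\<Sum>i\<in>I. push_exponents \<omega> (f i))"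
proof -
  have "push_exponents \<omega> 0 = 0" by (simp add: push_exponents_def)
  then show ?thesis
    by (induction I rule: infinite_finite_induct) (auto simp: push_exponents_add)
qed

lemma push_exponents_single:
  "push_exponents \<omega> (Poly_Mapping.single m c) = Poly_Mapping.single (\<omega> m) c"
  by (simp add: push_exponents_def)

text \<open>The monoid algebra is functorial; the assumptions on \<open>\<omega>\<close> say that it restricts to an isomorphism of
monoids.\<close>

lemma monoid_algebra_ring_iso:
  assumes bij: "bij_betw \<omega> G H" and zero: "\<omega> 0 = 0"
    and add: "\<And>a b. a \<in> G \<Longrightarrow> b \<in> G \<Longrightarrow> \<omega> (a + b) = \<omega> a + \<omega> b"
  shows "push_exponents \<omega> \<in> ring_iso (ring_on (monoid_algebra G))
    (ring_on (monoid_algebra H :: 'a::comm_ring_1 mpol set))"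
proof (rule ring_iso_memI)
  let ?s = "\<lambda>p m. Poly_Mapping.single m (Poly_Mapping.lookup p m)"
  have image: "push_exponents \<omega> p \<in> monoid_algebra H" if "p \<in> monoid_algebra G" for p :: "'a mpol"
    unfolding push_exponents_def using that bij
    by (intro sum_in_monoid_algebra single_in_monoid_algebra) (auto simp: monoid_algebra_def bij_betw_def)
  then show "push_exponents \<omega> x \<in> carrier (ring_on (monoid_algebra H))"
    if "x \<in> carrier (ring_on (monoid_algebra G))" for x :: "'a mpol" using that by simp
  show "push_exponents \<omega> (x \<otimes>\<^bsub>ring_on (monoid_algebra G)\<^esub> y)
      = push_exponents \<omega> x \<otimes>\<^bsub>ring_on (monoid_algebra H)\<^esub> push_exponents \<omega> y"
    if "x \<in> carrier (ring_on (monoid_algebra G))" "y \<in> carrier (ring_on (monoid_algebra G))" for x y :: "'a mpol"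
  proof -
    have "push_exponents \<omega> (x * y) = (\<Sum>a\<in>Poly_Mapping.keys x. \<Sum>b\<in>Poly_Mapping.keys y.
        Poly_Mapping.single (\<omega> (a + b)) (Poly_Mapping.lookup x a * Poly_Mapping.lookup y b))"
      by (simp only: mult_eq_sum_single[of x y] push_exponents_sum push_exponents_single)
    also have "\<dots> = (\<Sum>a\<in>Poly_Mapping.keys x. \<Sum>b\<in>Poly_Mapping.keys y.
        Poly_Mapping.single (\<omega> a) (Poly_Mapping.lookup x a)
        * Poly_Mapping.single (\<omega> b) (Poly_Mapping.lookup y b))"
    proof (intro sum.cong refl)
      fix a b assume "a \<in> Poly_Mapping.keys x" "b \<in> Poly_Mapping.keys y"
      then have "\<omega> (a + b) = \<omega> a + \<omega> b" using that by (intro add) (auto simp: monoid_algebra_def)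
      then show "Poly_Mapping.single (\<omega> (a + b)) (Poly_Mapping.lookup x a * Poly_Mapping.lookup y b)
          = Poly_Mapping.single (\<omega> a) (Poly_Mapping.lookup x a)
          * Poly_Mapping.single (\<omega> b) (Poly_Mapping.lookup y b)"
        by (simp add: mult_single)
    qed
    also have "\<dots> = push_exponents \<omega> x * push_exponents \<omega> y"
      by (simp only: push_exponents_def sum_product)
    finally show ?thesis by simp
  qed
  show "push_exponents \<omega> \<one>\<^bsub>ring_on (monoid_algebra G)\<^esub> = (\<one>\<^bsub>ring_on (monoid_algebra H)\<^esub> :: 'a mpol)"
    using push_exponents_single[of \<omega> 0 "1::'a"] zero by simp
  have inj: "inj_on \<omega> G" using bij by (simp add: bij_betw_def)
  have lookup: "Poly_Mapping.lookup (push_exponents \<omega> p) (\<omega> m) = Poly_Mapping.lookup p m"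
    if p: "p \<in> monoid_algebra G" and m: "m \<in> G" for p :: "'a mpol" and m
  proof -
    have "Poly_Mapping.lookup (push_exponents \<omega> p) (\<omega> m)
        = (\<Sum>k\<in>Poly_Mapping.keys p. if k = m then Poly_Mapping.lookup p k else 0)"
      unfolding push_exponents_def lookup_sum lookup_single
      by (rule sum.cong) (use p m inj in \<open>auto simp: monoid_algebra_def when_def dest: inj_onD\<close>)
    then show ?thesis by (simp add: in_keys_iff)
  qed
  have "inj_on (push_exponents \<omega>) (monoid_algebra G :: 'a mpol set)"
  proof (intro inj_onI poly_mapping_eqI)
    fix p q :: "'a mpol" and m
    assume *: "p \<in> monoid_algebra G" "q \<in> monoid_algebra G" "push_exponents \<omega> p = push_exponents \<omega> q"
    show "Poly_Mapping.lookup p m = Poly_Mapping.lookup q m"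
    proof (cases "m \<in> G")
      case True
      then show ?thesis using * lookup by metis
    next
      case False
      then have "m \<notin> Poly_Mapping.keys p" "m \<notin> Poly_Mapping.keys q" using * by (auto simp: monoid_algebra_def)
      then show ?thesis by (simp add: in_keys_iff)
    qed
  qed
  moreover have "q \<in> push_exponents \<omega> ` monoid_algebra G" if q: "q \<in> monoid_algebra H" for q :: "'a mpol"
  proof
    let ?\<omega>' = "inv_into G \<omega>"
    let ?p = "\<Sum>m\<in>Poly_Mapping.keys q. Poly_Mapping.single (?\<omega>' m) (Poly_Mapping.lookup q m)"
    have m: "?\<omega>' m \<in> G" "\<omega> (?\<omega>' m) = m" if "m \<in> Poly_Mapping.keys q" for m
    proof -
      have "m \<in> \<omega> ` G" using q that bij by (auto simp: monoid_algebra_def bij_betw_def)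
      then show "?\<omega>' m \<in> G" "\<omega> (?\<omega>' m) = m" by (auto intro: inv_into_into f_inv_into_f)
    qed
    show "?p \<in> monoid_algebra G" using m by (intro sum_in_monoid_algebra single_in_monoid_algebra)
    have "push_exponents \<omega> ?p = (\<Sum>m\<in>Poly_Mapping.keys q. ?s q m)"
      unfolding push_exponents_sum using m by (intro sum.cong) (auto simp: push_exponents_single)
    then show "q = push_exponents \<omega> ?p" by (simp only: poly_mapping_sum_single[symmetric])
  qed
  ultimately show "bij_betw (push_exponents \<omega>) (carrier (ring_on (monoid_algebra G)))
      (carrier (ring_on (monoid_algebra H :: 'a mpol set)))"
    using image by (auto simp: bij_betw_def)
qed (simp add: push_exponents_add)

section \<open>Chains of primes and algebraic independence\<close>

text \<open>Suppose that a polynomial in the \<open>x i\<close> lies in \<open>P i\<close>. Divide it by the largest possible power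
\<open>x i ^ a\<close>, which is not in the prime \<open>P i\<close>, and reduce modulo \<open>x i\<close>, which is in \<open>P (Suc i)\<close>. What
is left is a nontrivial polynomial in the later elements that lies in \<open>P (Suc i)\<close>. At the end of the
chain only a coefficient remains, and it would lie in the largest prime, which the hypotheses exclude.

Nonzero constants of a field are in no prime, so elements picked from the successive steps of a strict
chain of primes of an algebra over a field are algebraically independent.\<close>

lemma prime_chain_steps_independent:
  fixes A :: "'a::comm_ring_1 set" and P :: "nat \<Rightarrow> 'a set"
  assumes P: "\<And>i. i \<le> k \<Longrightarrow> primeideal (P i) (ring_on A)"
    and mono: "\<And>i. i < k \<Longrightarrow> P i \<subseteq> P (Suc i)"
    and x: "\<And>i. i < k \<Longrightarrow> x i \<in> P (Suc i)" "\<And>i. i < k \<Longrightarrow> x i \<notin> P i"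
    and "i \<le> k" and "finite E" and "E \<noteq> {}" and "inj_on (\<lambda>e. restrict e {i..<k}) E"
    and "\<And>e. e \<in> E \<Longrightarrow> c e \<in> A" and "\<And>e. e \<in> E \<Longrightarrow> c e \<notin> P k"
  shows "(\<Sum>e\<in>E. c e * (\<Prod>j\<in>{i..<k}. x j ^ e j)) \<notin> P i"
  using assms(5-)
proof (induction i arbitrary: E rule: inc_induct)
  case base
  from base(2) obtain e where e: "e \<in> E" by blast
  have "E = {e}" using base(3) e by (auto simp: inj_on_def)
  then show ?case using base(5)[of e] by simp
next
  case (step i)
  have cr: "cring (ring_on A)" using P[of i] step.hyps by (intro cring_of_primeideal_on) auto
  have xA: "x j \<in> A" if "j < k" for j
    using P[of "Suc j"] x(1)[OF that] that ideal_on_subset[OF ideal_of_primeideal_on]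
    by (meson Suc_leI subsetD)
  define a where "a = Min ((\<lambda>e. e i) ` E)"
  have a_le: "a \<le> e i" if "e \<in> E" for e using that step.prems by (simp add: a_def)
  define E' where "E' = {e \<in> E. e i = a}"
  have "a \<in> (\<lambda>e. e i) ` E" unfolding a_def using step.prems by (intro Min_in) auto
  then have ne: "E' \<noteq> {}" by (auto simp: E'_def)
  let ?m = "\<lambda>e. \<Prod>j\<in>{Suc i..<k}. x j ^ e j"
  let ?g = "\<Sum>e\<in>E'. c e * ?m e"
  define h where "h = (\<Sum>e\<in>E - E'. c e * x i ^ (e i - Suc a) * ?m e)"
  have mA: "?m e \<in> A" for e
    using xA by (intro prod_in_cring_on[OF cr] power_in_cring_on[OF cr]) auto
  have hA: "h \<in> A" unfolding h_def using step.prems step.hyps mA xA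
    by (intro sum_in_cring_on[OF cr] mult_in_cring_on[OF cr] power_in_cring_on[OF cr]) auto
  have gA: "?g \<in> A" using step.prems mA
    by (intro sum_in_cring_on[OF cr] mult_in_cring_on[OF cr]) (auto simp: E'_def)
  have inj: "inj_on (\<lambda>e. restrict e {Suc i..<k}) E'"
  proof (rule inj_onI)
    fix e f assume ef: "e \<in> E'" "f \<in> E'" and eq: "restrict e {Suc i..<k} = restrict f {Suc i..<k}"
    have "restrict e {i..<k} = restrict f {i..<k}"
    proof (rule restrict_ext)
      fix j assume j: "j \<in> {i..<k}"
      show "e j = f j"
      proof (cases "j = i")
        case True
        then show ?thesis using ef by (simp add: E'_def)
      next
        case False
        then show ?thesis using fun_cong[OF eq, of j] j by simp
      qed
    qed
    then show "e = f" using ef by (auto intro: inj_onD[OF step.prems(3), of e f] simp: E'_def simp del: restrict_apply)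
  qed
  have "?g \<notin> P (Suc i)"
    using step.prems(1,4,5) by (intro step.IH[OF _ ne inj]) (auto simp: E'_def)
  show ?case
  proof
    assume "(\<Sum>e\<in>E. c e * (\<Prod>j\<in>{i..<k}. x j ^ e j)) \<in> P i"
    also have "(\<Sum>e\<in>E. c e * (\<Prod>j\<in>{i..<k}. x j ^ e j)) = (\<Sum>e\<in>E. c e * (x i ^ e i * ?m e))"
      using step.hyps by (simp add: prod.atLeast_Suc_lessThan)
    also have "\<dots> = (\<Sum>e\<in>E'. c e * (x i ^ e i * ?m e)) + (\<Sum>e\<in>E - E'. c e * (x i ^ e i * ?m e))"
      using step.prems by (subst add.commute, intro sum.subset_diff) (auto simp: E'_def)
    also have "(\<Sum>e\<in>E'. c e * (x i ^ e i * ?m e)) = x i ^ a * ?g"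
      unfolding sum_distrib_left by (rule sum.cong) (auto simp: E'_def algebra_simps)
    also have "(\<Sum>e\<in>E - E'. c e * (x i ^ e i * ?m e)) = x i ^ a * (x i * h)"
      unfolding h_def sum_distrib_left
    proof (rule sum.cong)
      fix e assume "e \<in> E - E'"
      then have "e i = a + Suc (e i - Suc a)" using a_le[of e] by (auto simp: E'_def)
      then have "x i ^ e i = x i ^ a * (x i * x i ^ (e i - Suc a))"
        by (metis power_add power_Suc)
      then show "c e * (x i ^ e i * ?m e) = x i ^ a * (x i * (c e * x i ^ (e i - Suc a) * ?m e))"
        by (simp only: mult_ac)
    qed simp
    finally have "x i ^ a * (?g + x i * h) \<in> P i" by (simp only: distrib_left)
    moreover have "x i ^ a \<notin> P i"
      using P[of i] x(2)[of i] xA[of i] step.hyps by (intro power_notin_primeideal_on) auto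
    moreover have "?g + x i * h \<in> A" "x i ^ a \<in> A"
      using gA hA xA step.hyps
      by (simp_all add: add_in_cring_on[OF cr] mult_in_cring_on[OF cr] power_in_cring_on[OF cr])
    ultimately have "?g + x i * h \<in> P i"
      using P[of i] step.hyps by (meson primeideal_on_prime less_imp_le)
    then have "?g + x i * h \<in> P (Suc i)" using mono[of i] step.hyps by auto
    moreover have "x i * h \<in> P (Suc i)"
      using P[of "Suc i"] x(1)[of i] step.hyps hA by (intro mult_in_ideal_on[OF ideal_of_primeideal_on]) auto
    ultimately have "?g + x i * h - x i * h \<in> P (Suc i)"
      using P[of "Suc i"] step.hyps by (intro diff_in_primeideal_on) auto
    then show False using \<open>?g \<notin> P (Suc i)\<close> by simp
  qed
qed

text \<open>The dimension is bounded by the growth of the monoid. If the coordinates in \<open>T\<close> determine the elements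
of \<open>G\<close>, then at most \<open>(N + 1) ^ r\<close> of them, where \<open>r = card T\<close>, have all these coordinates bounded by
\<open>N\<close>. But \<open>r + 1\<close> algebraically independent elements of the monoid algebra have \<open>(M + 1) ^ (r + 1)\<close>
linearly independent monomials with exponents up to \<open>M\<close>, and the coordinates that occur in these grow
only linearly in \<open>M\<close>.\<close>

lemma krull_dim_monoid_algebra_le:
  fixes G :: "(nat \<Rightarrow>\<^sub>0 nat) set"
  assumes G: "exponent_monoid G" and "finite T"
    and inj: "inj_on (\<lambda>m. restrict (Poly_Mapping.lookup m) T) G"
  shows "krull_dim (ring_on (monoid_algebra G :: 'k::field mpol set)) \<le> enat (card T)"
  unfolding krull_dim_def
proof (rule Sup_least, clarify, rule ccontr)
  fix k and P :: "nat \<Rightarrow> 'k mpol set"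
  let ?A = "monoid_algebra G :: 'k mpol set"
  define r where "r = card T"
  assume P: "\<forall>i\<le>k. primeideal (P i) (ring_on ?A)" and strict: "\<forall>i<k. P i \<subset> P (Suc i)"
    and "\<not> enat k \<le> enat (card T)"
  then have rk: "Suc r \<le> k" by (simp add: r_def)
  have "\<forall>i. \<exists>x. i < k \<longrightarrow> x \<in> P (Suc i) \<and> x \<notin> P i" using strict by blast
  then obtain x where x: "\<And>i. i < k \<Longrightarrow> x i \<in> P (Suc i)" "\<And>i. i < k \<Longrightarrow> x i \<notin> P i" by metis
  have xA: "Poly_Mapping.keys (x i) \<subseteq> G" if "i < Suc r" for i
    using ideal_on_subset[OF ideal_of_primeideal_on, of "P (Suc i)" ?A] P x(1)[of i] rk that
    by (auto simp: monoid_algebra_def)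

  define H where "H N = {m \<in> G. \<forall>i\<in>T. Poly_Mapping.lookup m i \<le> N}" for N
  have H_inj: "inj_on (\<lambda>m. restrict (Poly_Mapping.lookup m) T) (H N)" for N
    by (rule inj_on_subset[OF inj]) (auto simp: H_def)
  have H_img: "(\<lambda>m. restrict (Poly_Mapping.lookup m) T) ` H N \<subseteq> T \<rightarrow>\<^sub>E {..N}" for N
    by (auto simp: H_def)
  have fin: "finite (T \<rightarrow>\<^sub>E {..N})" for N :: nat using \<open>finite T\<close> by (intro finite_PiE) auto
  have H_card: "card (H N) \<le> Suc N ^ r" for N
    using card_inj_on_le[OF H_inj H_img fin] \<open>finite T\<close> by (simp add: card_PiE r_def)
  have H_fin: "finite (H N)" for N
    using finite_imageD[OF finite_subset[OF H_img fin] H_inj] .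
  have H_mono: "N \<le> M \<Longrightarrow> H N \<subseteq> H M" for N M by (auto simp: H_def)
  have H_mult: "Poly_Mapping.keys (p * q) \<subseteq> H (N + M)"
    if pq: "Poly_Mapping.keys p \<subseteq> H N" "Poly_Mapping.keys q \<subseteq> H M" for p q :: "'k mpol" and N M
  proof
    fix m assume "m \<in> Poly_Mapping.keys (p * q)"
    then obtain a b where m: "m = a + b" "a \<in> H N" "b \<in> H M" using keys_mult[of p q] pq by blast
    then show "m \<in> H (N + M)"
      using G by (auto simp: H_def exponent_monoid_def lookup_add intro!: add_mono)
  qed
  have H_one: "Poly_Mapping.keys (1::'k mpol) \<subseteq> H 0"
    using G by (auto simp: H_def exponent_monoid_def)
  have H_pow: "Poly_Mapping.keys (p ^ e) \<subseteq> H (e * N)"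
    if "Poly_Mapping.keys p \<subseteq> H N" for p :: "'k mpol" and e N
  proof (induction e)
    case (Suc e)
    then show ?case using H_mult[OF that Suc] by simp
  qed (use H_one in simp)
  have H_prod: "Poly_Mapping.keys (\<Prod>j\<in>J. f j) \<subseteq> H (\<Sum>j\<in>J. N j)"
    if "\<And>j. j \<in> J \<Longrightarrow> Poly_Mapping.keys (f j) \<subseteq> H (N j)" for J :: "nat set" and f :: "nat \<Rightarrow> 'k mpol" and N
    using that
  proof (induction J rule: infinite_finite_induct)
    case (insert j J)
    then show ?case using H_mult[of "f j" "N j" "prod f J" "sum N J"] by simp
  qed (use H_one in simp_all)

  define U where "U = (\<Union>j<Suc r. \<Union>m\<in>Poly_Mapping.keys (x j). Poly_Mapping.lookup m ` T)"
  have "finite U" unfolding U_def using \<open>finite T\<close> by (intro finite_UN_I finite_imageI) auto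
  then obtain D where le_D: "\<And>d. d \<in> U \<Longrightarrow> d \<le> D"
    using finite_nat_set_iff_bounded_le[of U] by blast
  have D: "Poly_Mapping.keys (x j) \<subseteq> H D" if j: "j < Suc r" for j
  proof
    fix m assume m: "m \<in> Poly_Mapping.keys (x j)"
    then have "Poly_Mapping.lookup m i \<in> U" if "i \<in> T" for i
      unfolding U_def using j that by blast
    then show "m \<in> H D" unfolding H_def using xA[OF j] m le_D by blast
  qed

  \<comment> \<open>Monomials in the \<open>x j\<close> with exponents up to \<open>M\<close> have coordinates up to \<open>N\<close>. As
    \<open>N + 1 \<le> ((r + 1) D + 1) (M + 1)\<close>, this choice of \<open>M\<close> gives \<open>(N + 1) ^ r \<le> M (M + 1) ^ r\<close>, which
    is less than the number of these monomials.\<close>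
  define M where "M = Suc (Suc r * D) ^ r"
  define N where "N = Suc r * M * D"
  define E where "E = {..<Suc r} \<rightarrow>\<^sub>E {..M}"
  define v where "v e = (\<Prod>j\<in>{0..<Suc r}. x j ^ e j)" for e
  have E_fin: "finite E" unfolding E_def by (intro finite_PiE) auto
  have v: "Poly_Mapping.keys (v e) \<subseteq> H N" if "e \<in> E" for e
  proof -
    have "Poly_Mapping.keys (v e) \<subseteq> H (\<Sum>j\<in>{0..<Suc r}. e j * D)"
      unfolding v_def using D by (intro H_prod H_pow) auto
    moreover have "(\<Sum>j\<in>{0..<Suc r}. e j * D) \<le> (\<Sum>j\<in>{0..<Suc r}. M * D)"
      using that by (intro sum_mono mult_right_mono) (auto simp: E_def PiE_iff)
    moreover have "(\<Sum>j\<in>{0..<Suc r}. M * D) = N" by (simp add: N_def algebra_simps)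
    ultimately show ?thesis using H_mono by (metis order.trans)
  qed
  have "card (H N) \<le> Suc N ^ r" by (rule H_card)
  also have "\<dots> \<le> (Suc (Suc r * D) * Suc M) ^ r"
    by (intro power_mono) (auto simp: N_def algebra_simps)
  also have "\<dots> = M * Suc M ^ r" by (simp only: power_mult_distrib M_def[symmetric])
  also have "\<dots> < Suc M * Suc M ^ r" by (intro mult_strict_right_mono) auto
  also have "\<dots> = card E" by (simp add: E_def card_PiE)
  finally obtain c where c: "\<exists>e\<in>E. c e \<noteq> 0"
    "\<And>m. m \<in> H N \<Longrightarrow> (\<Sum>e\<in>E. c e * Poly_Mapping.lookup (v e) m) = 0"
    using homogeneous_system_nontrivial[OF H_fin E_fin, of N "\<lambda>e. Poly_Mapping.lookup (v e)"] by blast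
  define E' where "E' = {e \<in> E. c e \<noteq> 0}"
  have "(\<Sum>e\<in>E'. Const (c e) * v e) = (\<Sum>e\<in>E. Const (c e) * v e)"
    using E_fin by (intro sum.mono_neutral_left) (auto simp: E'_def Const_def)
  also have "\<dots> = 0"
  proof (rule poly_mapping_eqI)
    fix m
    have "(\<Sum>e\<in>E. c e * Poly_Mapping.lookup (v e) m) = 0"
    proof (cases "m \<in> H N")
      case False
      then have "Poly_Mapping.lookup (v e) m = 0" if "e \<in> E" for e
        using v[OF that] by (auto simp: in_keys_iff)
      then show ?thesis by simp
    qed (rule c(2))
    then show "Poly_Mapping.lookup (\<Sum>e\<in>E. Const (c e) * v e) m = Poly_Mapping.lookup 0 m"
      by (simp add: lookup_sum lookup_Const_mult)
  qed
  finally have zero: "(\<Sum>e\<in>E'. Const (c e) * v e) = 0" .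
  have "(\<Sum>e\<in>E'. Const (c e) * (\<Prod>j\<in>{0..<Suc r}. x j ^ e j)) \<notin> P 0"
  proof (rule prime_chain_steps_independent[where A = ?A])
    show "primeideal (P i) (ring_on ?A)" if "i \<le> Suc r" for i using P rk that by simp
    show "P i \<subseteq> P (Suc i)" if "i < Suc r" for i
      using strict rk that by (intro psubset_imp_subset) auto
    show "x i \<in> P (Suc i)" "x i \<notin> P i" if "i < Suc r" for i using x rk that by auto
    show "finite E'" "E' \<noteq> {}" using E_fin c(1) by (auto simp: E'_def)
    have ext: "restrict e {0..<Suc r} = e" if "e \<in> E" for e
      using that by (auto simp: E_def PiE_iff lessThan_atLeast0 extensional_restrict)
    show "inj_on (\<lambda>e. restrict e {0..<Suc r}) E'"
      using ext unfolding E'_def inj_on_def by (metis (no_types, lifting) mem_Collect_eq)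
    show "Const (c e) \<in> ?A" for e using Const_in_monoid_algebra[OF G] .
    show "Const (c e) \<notin> P (Suc r)" if "e \<in> E'" for e
    proof
      have Pr: "primeideal (P (Suc r)) (ring_on ?A)" using P rk by simp
      assume "Const (c e) \<in> P (Suc r)"
      then have "Const (c e) * Const (inverse (c e)) \<in> P (Suc r)"
        using mult_in_ideal_on[OF ideal_of_primeideal_on[OF Pr]] Const_in_monoid_algebra[OF G] by blast
      then have "1 \<in> P (Suc r)" using that by (simp add: Const_def mult_single E'_def)
      then show False
        using one_notin_primeideal_on[OF Pr] by blast
    qed
  qed simp
  then show False using zero zero_in_ideal_on[OF ideal_of_primeideal_on, of "P 0" ?A] P by (simp add: v_def)
qed

section \<open>Polynomial rings as monoid algebras\<close>

lemma mpols_induct [consumes 1, case_names Const Var add mult]: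
  fixes p :: "'a::comm_ring_1 mpol"
  assumes p: "p \<in> mpols V" and Const: "\<And>c. P (Const c)" and Var: "\<And>i. i \<in> V \<Longrightarrow> P (Var i)"
    and add: "\<And>p q. p \<in> mpols V \<Longrightarrow> q \<in> mpols V \<Longrightarrow> P p \<Longrightarrow> P q \<Longrightarrow> P (p + q)"
    and mult: "\<And>p q. p \<in> mpols V \<Longrightarrow> q \<in> mpols V \<Longrightarrow> P p \<Longrightarrow> P q \<Longrightarrow> P (p * q)"
  shows "P p"
proof -
  have monomial: "P (Poly_Mapping.single m 1)" if "Poly_Mapping.keys m \<subseteq> V" for m
    using that
  proof (induction "tdeg m" arbitrary: m)
    case 0
    then show ?case using Const[of 1] by (simp add: Const_def)
  next
    case (Suc k)
    then have "Poly_Mapping.keys m \<noteq> {}" by (auto simp: tdeg_def)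
    then obtain i where i: "i \<in> Poly_Mapping.keys m" by blast
    obtain m' where m: "m = Poly_Mapping.single i 1 + m'" using exponent_split_variable[OF i] .
    have keys: "Poly_Mapping.keys m' \<subseteq> V" "i \<in> V" using Suc.prems i m by (auto simp: keys_exponent_add)
    have "P (Poly_Mapping.single m' 1)" using Suc.hyps m keys by (simp add: tdeg_add)
    moreover have "Poly_Mapping.single m' 1 \<in> mpols V" using keys by (simp add: mpols_def)
    ultimately have "P (Var i * Poly_Mapping.single m' 1)"
      using keys by (intro mult Var Var_in_mpols)
    then show ?case by (simp add: Var_def mult_single m)
  qed
  have term_in: "P (Poly_Mapping.single m c) \<and> Poly_Mapping.single m c \<in> mpols V"
    if "Poly_Mapping.keys m \<subseteq> V" for m c
  proof -
    have "P (Const c * Poly_Mapping.single m 1)"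
      using that by (intro mult Const monomial Const_in_mpols) (simp_all add: mpols_def)
    then show ?thesis using that by (simp add: Const_def mult_single mpols_def)
  qed
  have sum: "P (\<Sum>m\<in>M. f m) \<and> (\<Sum>m\<in>M. f m) \<in> mpols V"
    if "\<And>m. m \<in> M \<Longrightarrow> P (f m) \<and> f m \<in> mpols V" for M :: "(nat \<Rightarrow>\<^sub>0 nat) set" and f
    using that
  proof (induction M rule: infinite_finite_induct)
    case (insert x F)
    then show ?case by (simp add: add add_in_mpols)
  qed (use Const[of 0] zero_in_mpols in \<open>auto simp: Const_def\<close>)
  have "P (\<Sum>m\<in>Poly_Mapping.keys p. Poly_Mapping.single m (Poly_Mapping.lookup p m))"
    by (rule conjunct1, rule sum, rule term_in) (use p in \<open>auto simp: mpols_def\<close>)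
  then show ?thesis by (simp only: poly_mapping_sum_single[symmetric])
qed

text \<open>The monomials in the last \<open>m - i\<close> variables form a face, and these faces are a chain of length \<open>m\<close>.\<close>

lemma variables_le_krull_dim: "enat m \<le> krull_dim (mpol_ring {..<m} :: 'k::idom mpol ring)"
  unfolding mpols_eq_monoid_algebra
proof (rule face_chain_le_krull_dim[OF exponent_monoid_keys_subset])
  let ?F = "\<lambda>i. {e :: nat \<Rightarrow>\<^sub>0 nat. Poly_Mapping.keys e \<subseteq> {i..<m}}"
  show "face {e. Poly_Mapping.keys e \<subseteq> {..<m}} (?F i)" for i
    by (auto simp: face_def keys_exponent_add)
  show "?F (Suc i) \<subset> ?F i" if "i < m" for i
  proof
    show "?F (Suc i) \<subseteq> ?F i" by (force simp: subset_iff)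
    have "Poly_Mapping.single i 1 \<in> ?F i - ?F (Suc i)" using that by auto
    then show "?F (Suc i) \<noteq> ?F i" by blast
  qed
qed

text \<open>The coefficient of an indecomposable exponent obeys the Leibniz rule of a derivation at the origin.\<close>

lemma lookup_mult_indecomposable:
  fixes p q :: "'a::comm_ring_1 mpol"
  assumes "p \<in> monoid_algebra G" and "q \<in> monoid_algebra G" and "e \<noteq> 0"
    and "\<And>a b. a \<in> G \<Longrightarrow> b \<in> G \<Longrightarrow> a + b = e \<Longrightarrow> a = 0 \<or> b = 0"
  shows "Poly_Mapping.lookup (p * q) e =
    Poly_Mapping.lookup p 0 * Poly_Mapping.lookup q e + Poly_Mapping.lookup p e * Poly_Mapping.lookup q 0"
proof -
  let ?p = "Poly_Mapping.lookup p" and ?q = "Poly_Mapping.lookup q"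
  have "Poly_Mapping.lookup (p * q) e
      = (\<Sum>a\<in>Poly_Mapping.keys p. \<Sum>b\<in>Poly_Mapping.keys q. (?p a * ?q b when a + b = e))"
    unfolding mult_eq_sum_single[of p q] by (simp add: lookup_sum lookup_single)
  also have "\<dots> = (\<Sum>a\<in>Poly_Mapping.keys p. \<Sum>b\<in>Poly_Mapping.keys q.
      (if a = 0 then ?p a else 0) * (if b = e then ?q b else 0)
      + (if a = e then ?p a else 0) * (if b = 0 then ?q b else 0))"
  proof (intro sum.cong refl)
    fix a b assume ab: "a \<in> Poly_Mapping.keys p" "b \<in> Poly_Mapping.keys q"
    then have "a \<in> G" "b \<in> G" using assms(1,2) by (auto simp: monoid_algebra_def)
    then have "a + b = e \<longleftrightarrow> (a = 0 \<and> b = e) \<or> (a = e \<and> b = 0)"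
      using assms(4)[of a b] by auto
    then show "(?p a * ?q b when a + b = e) = (if a = 0 then ?p a else 0) * (if b = e then ?q b else 0)
      + (if a = e then ?p a else 0) * (if b = 0 then ?q b else 0)"
      using \<open>e \<noteq> 0\<close> by (auto simp: when_def)
  qed
  also have "\<dots> = ?p 0 * ?q e + ?p e * ?q 0"
    by (simp add: sum.distrib sum_product[symmetric] in_keys_iff)
  finally show ?thesis .
qed

text \<open>This bounds the embedding dimension at the origin. If there were more indecomposables than variables,
some nonzero combination \<open>D\<close> of their coefficient functionals would vanish on the images of all
variables. By the Leibniz rule \<open>D\<close> would then vanish everywhere, contradicting its value \<open>c j\<close> on the
monomial with exponent \<open>e j\<close>.\<close>

lemma indecomposables_le_variables:
  assumes G: "exponent_monoid G" and "finite J" and "inj_on e J" and eG: "e ` J \<subseteq> G"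
    and indec: "\<And>j a b. j \<in> J \<Longrightarrow> a \<in> G \<Longrightarrow> b \<in> G \<Longrightarrow> a + b = e j \<Longrightarrow> a = 0 \<or> b = 0"
    and e0: "\<And>j. j \<in> J \<Longrightarrow> e j \<noteq> 0"
    and \<phi>: "\<phi> \<in> ring_iso (mpol_ring {..<m}) (ring_on (monoid_algebra G :: 'k::field mpol set))"
    and const: "\<And>c. \<phi> (Const c) = Const c"
  shows "card J \<le> m"
proof (rule ccontr)
  assume "\<not> card J \<le> m"
  then obtain c where c: "\<exists>j\<in>J. c j \<noteq> 0"
    "\<And>i. i < m \<Longrightarrow> (\<Sum>j\<in>J. c j * Poly_Mapping.lookup (\<phi> (Var i)) (e j)) = 0"
    using homogeneous_system_nontrivial[OF finite_lessThan[of m] \<open>finite J\<close>,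
        of "\<lambda>j i. Poly_Mapping.lookup (\<phi> (Var i)) (e j)"] by auto
  define D where "D q = (\<Sum>j\<in>J. c j * Poly_Mapping.lookup q (e j))" for q :: "'k mpol"
  have "D (\<phi> p) = 0" if "p \<in> mpols {..<m}" for p
    using that
  proof (induction rule: mpols_induct)
    case (Const a)
    have "Poly_Mapping.lookup (Const a) (e j) = 0" if "j \<in> J" for j
      using e0[OF that] by (simp add: Const_def lookup_single)
    then show ?case by (simp add: const D_def)
  next
    case (Var i)
    then show ?case using c(2) by (simp add: D_def)
  next
    case (add p q)
    have "\<phi> (p + q) = \<phi> p + \<phi> q" using ring_iso_memE(3)[OF \<phi>] add.hyps by simp
    then show ?case using add.IH by (simp add: D_def lookup_add algebra_simps sum.distrib)
  next
    case (mult p q)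
    let ?p = "\<phi> p" and ?q = "\<phi> q"
    have pq: "?p \<in> monoid_algebra G" "?q \<in> monoid_algebra G"
      using ring_iso_memE(1)[OF \<phi>] mult.hyps by simp_all
    have "\<phi> (p * q) = ?p * ?q" using ring_iso_memE(2)[OF \<phi>] mult.hyps by simp
    then have "D (\<phi> (p * q)) = (\<Sum>j\<in>J. Poly_Mapping.lookup ?p 0 * (c j * Poly_Mapping.lookup ?q (e j))
        + Poly_Mapping.lookup ?q 0 * (c j * Poly_Mapping.lookup ?p (e j)))"
      unfolding D_def
      by (intro sum.cong) (simp_all add: lookup_mult_indecomposable[OF pq e0 indec] algebra_simps)
    also have "\<dots> = Poly_Mapping.lookup ?p 0 * D ?q + Poly_Mapping.lookup ?q 0 * D ?p"
      by (simp add: D_def sum.distrib sum_distrib_left)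
    finally show ?case using mult.IH by simp
  qed
  moreover have "q \<in> \<phi> ` mpols {..<m}" if "q \<in> monoid_algebra G" for q
    using \<phi> that by (simp add: ring_iso_def bij_betw_def)
  ultimately have D0: "D q = 0" if "q \<in> monoid_algebra G" for q using that by blast
  obtain j where j: "j \<in> J" "c j \<noteq> 0" using c(1) by blast
  have "D (Poly_Mapping.single (e j) 1) = (\<Sum>i\<in>J. if i = j then c i else 0)"
    unfolding D_def lookup_single
    by (rule sum.cong) (use j \<open>inj_on e J\<close> in \<open>auto simp: when_def dest: inj_onD\<close>)
  then have "D (Poly_Mapping.single (e j) 1) = c j" using j \<open>finite J\<close> by simp
  moreover have "Poly_Mapping.single (e j) (1::'k) \<in> monoid_algebra G"
    using j eG by (intro single_in_monoid_algebra) auto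
  ultimately show False using D0 j by simp
qed

section \<open>The fiber cone of an ideal generated by monomials of one degree\<close>

primrec iterated_sumset :: "(nat \<Rightarrow>\<^sub>0 nat) set \<Rightarrow> nat \<Rightarrow> (nat \<Rightarrow>\<^sub>0 nat) set"
  where "iterated_sumset B 0 = {0}"
  | "iterated_sumset B (Suc k) = {b + m | b m. b \<in> B \<and> m \<in> iterated_sumset B k}"

definition monoid_span :: "(nat \<Rightarrow>\<^sub>0 nat) set \<Rightarrow> (nat \<Rightarrow>\<^sub>0 nat) set"
  where "monoid_span B = (\<Union>k. iterated_sumset B k)"

lemma iterated_sumset_add:
  "a \<in> iterated_sumset B k \<Longrightarrow> b \<in> iterated_sumset B l \<Longrightarrow> a + b \<in> iterated_sumset B (k + l)"
  by (induction k arbitrary: a) (auto simp: add.assoc, blast)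

lemma exponent_monoid_monoid_span: "exponent_monoid (monoid_span B)"
  unfolding exponent_monoid_def monoid_span_def
proof (intro conjI ballI)
  show "0 \<in> (\<Union>k. iterated_sumset B k)" by (rule UN_I[of 0]) auto
  fix a b assume "a \<in> (\<Union>k. iterated_sumset B k)" "b \<in> (\<Union>k. iterated_sumset B k)"
  then show "a + b \<in> (\<Union>k. iterated_sumset B k)" by (auto intro: iterated_sumset_add)
qed

lemma monoid_span_incl: "b \<in> B \<Longrightarrow> b \<in> monoid_span B"
  unfolding monoid_span_def by (rule UN_I[of 1]) auto

lemma monoid_span_least:
  assumes "exponent_monoid G" and "B \<subseteq> G"
  shows "monoid_span B \<subseteq> G"
proof -
  have "m \<in> G" if "m \<in> iterated_sumset B k" for k m
    using that assms by (induction k arbitrary: m) (auto simp: exponent_monoid_def)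
  then show ?thesis by (auto simp: monoid_span_def)
qed

text \<open>The exponents of the coefficients of \<open>s ^ k\<close> in the Rees algebra, see \<open>rees_carrier_eq\<close> below.\<close>

definition rees_exponents :: "nat \<Rightarrow> (nat \<Rightarrow>\<^sub>0 nat) set \<Rightarrow> nat \<Rightarrow> (nat \<Rightarrow>\<^sub>0 nat) set"
  where "rees_exponents n B k =
    {m. Poly_Mapping.keys m \<subseteq> {..<n} \<and> (\<exists>b\<in>iterated_sumset B k. \<exists>m'. m = b + m')}"

text \<open>In the Rees algebra of an ideal generated in degree \<open>t\<close>, the monomials of total degree \<open>k * t\<close> are
the ones of least possible degree in the coefficient of \<open>s ^ k\<close>.\<close>

definition minimal_part :: "nat \<Rightarrow> 'a::comm_ring_1 mpol poly \<Rightarrow> 'a mpol poly"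
  where "minimal_part t p =
    (\<Sum>k\<le>degree p. Polynomial.monom (restrict_keys {m. tdeg m = k * t} (poly.coeff p k)) k)"

text \<open>Setting \<open>s = 1\<close> loses nothing on minimal parts, since the power of \<open>s\<close> is determined by the total
degree.\<close>

definition fiber_map :: "nat \<Rightarrow> 'a::comm_ring_1 mpol poly \<Rightarrow> 'a mpol"
  where "fiber_map t p = poly (minimal_part t p) 1"

lemma coeff_minimal_part:
  "poly.coeff (minimal_part t p) k = restrict_keys {m. tdeg m = k * t} (poly.coeff p k)"
proof (cases "k \<le> degree p")
  case True
  then show ?thesis unfolding minimal_part_def by (rule coeff_sum_monom)
next
  case False
  then show ?thesis by (simp add: minimal_part_def coeff_sum coeff_eq_0)
qed

lemma minimal_part_add: "minimal_part t (p + q) = minimal_part t p + minimal_part t q"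
  by (rule poly_eqI) (simp add: coeff_minimal_part restrict_keys_add)

lemma fiber_map_add: "fiber_map t (p + q) = fiber_map t p + fiber_map t q"
  by (simp add: fiber_map_def minimal_part_add)

lemma fiber_map_0: "fiber_map t 0 = 0"
  by (simp add: fiber_map_def minimal_part_def)

lemma fiber_map_sum: "fiber_map t (\<Sum>i\<in>I. f i) = (\<Sum>i\<in>I. fiber_map t (f i))"
  by (induction I rule: infinite_finite_induct) (auto simp: fiber_map_add fiber_map_0)

lemma lookup_fiber_map:
  assumes "0 < t"
  shows "Poly_Mapping.lookup (fiber_map t p) m =
    (Poly_Mapping.lookup (poly.coeff p (tdeg m div t)) m when t dvd tdeg m)"
proof -
  let ?c = "\<lambda>k. Poly_Mapping.lookup (poly.coeff (minimal_part t p) k) m"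
  have "Poly_Mapping.lookup (fiber_map t p) m = (\<Sum>k\<le>degree (minimal_part t p). ?c k)"
    by (simp add: fiber_map_def poly_altdef lookup_sum)
  also have "\<dots> = (\<Sum>k\<in>{tdeg m div t}. ?c k)"
  proof (rule sum.mono_neutral_cong)
    show "?c k = 0" if "k \<in> {tdeg m div t} - {..degree (minimal_part t p)}" for k
      using that by (simp add: coeff_eq_0)
    show "?c k = 0" if "k \<in> {..degree (minimal_part t p)} - {tdeg m div t}" for k
      using that assms by (auto simp: coeff_minimal_part when_def)
  qed auto
  also have "\<dots> = (Poly_Mapping.lookup (poly.coeff p (tdeg m div t)) m when t dvd tdeg m)"
    by (auto simp: coeff_minimal_part when_def) (metis dvd_triv_right)
  finally show ?thesis .
qed

lemma fiber_map_monom: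
  "tdeg m = k * t \<Longrightarrow> fiber_map t (Polynomial.monom (Poly_Mapping.single m c) k) = Poly_Mapping.single m c"
proof -
  assume m: "tdeg m = k * t"
  have "minimal_part t (Polynomial.monom (Poly_Mapping.single m c) k) = Polynomial.monom (Poly_Mapping.single m c) k"
    by (rule poly_eqI) (auto simp: coeff_minimal_part restrict_keys_single m)
  then show ?thesis by (simp add: fiber_map_def poly_monom)
qed

lemma poly_sum_monom_single:
  "p = (\<Sum>k\<le>degree p. \<Sum>m\<in>Poly_Mapping.keys (poly.coeff p k).
    Polynomial.monom (Poly_Mapping.single m (Poly_Mapping.lookup (poly.coeff p k) m)) k)"
proof -
  have "p = (\<Sum>k\<le>degree p. Polynomial.monom (poly.coeff p k) k)" by (rule poly_as_sum_of_monoms[symmetric])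
  also have "\<dots> = (\<Sum>k\<le>degree p. \<Sum>m\<in>Poly_Mapping.keys (poly.coeff p k).
    Polynomial.monom (Poly_Mapping.single m (Poly_Mapping.lookup (poly.coeff p k) m)) k)"
    by (simp only: monom_sum[symmetric] poly_mapping_sum_single[symmetric])
  finally show ?thesis .
qed

text \<open>Equal degrees make \<open>monoid_span B\<close> graded: the number of summands of an element is its total degree
divided by \<open>t\<close>.\<close>

definition equigenerated :: "nat \<Rightarrow> nat \<Rightarrow> (nat \<Rightarrow>\<^sub>0 nat) set \<Rightarrow> bool"
  where "equigenerated n t B \<longleftrightarrow>
    0 < t \<and> (\<forall>b\<in>B. Poly_Mapping.keys b \<subseteq> {..<n} \<and> tdeg b = t)"

lemma equigeneratedD:
  assumes "equigenerated n t B"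
  shows t_pos: "0 < t"
    and keys_gen: "b \<in> B \<Longrightarrow> Poly_Mapping.keys b \<subseteq> {..<n}"
    and tdeg_gen: "b \<in> B \<Longrightarrow> tdeg b = t"
  using assms by (auto simp: equigenerated_def)

abbreviation monomial_ideal :: "nat \<Rightarrow> (nat \<Rightarrow>\<^sub>0 nat) set \<Rightarrow> 'k::field mpol set"
  where "monomial_ideal n B \<equiv> Idl\<^bsub>mpol_ring {..<n}\<^esub> ((\<lambda>b. Poly_Mapping.single b 1) ` B)"

lemma tdeg_iterated_sumset:
  assumes eq: "equigenerated n t B"
  shows "m \<in> iterated_sumset B k \<Longrightarrow> tdeg m = k * t"
  by (induction k arbitrary: m) (auto simp: tdeg_add tdeg_gen[OF eq])

lemma keys_iterated_sumset:
  assumes eq: "equigenerated n t B"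
  shows "m \<in> iterated_sumset B k \<Longrightarrow> Poly_Mapping.keys m \<subseteq> {..<n}"
  by (induction k arbitrary: m) (use keys_gen[OF eq] in \<open>fastforce simp: keys_exponent_add\<close>)+

lemma tdeg_rees_exponents:
  assumes eq: "equigenerated n t B"
  shows "m \<in> rees_exponents n B k \<Longrightarrow> k * t \<le> tdeg m"
  by (auto simp: rees_exponents_def tdeg_add tdeg_iterated_sumset[OF eq])

lemma rees_exponents_add:
  "a \<in> rees_exponents n B k \<Longrightarrow> b \<in> rees_exponents n B l \<Longrightarrow> a + b \<in> rees_exponents n B (k + l)"
  unfolding rees_exponents_def
proof clarsimp
  fix u u' v v' assume *: "Poly_Mapping.keys (u + u') \<subseteq> {..<n}" "Poly_Mapping.keys (v + v') \<subseteq> {..<n}"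
    "u \<in> iterated_sumset B k" "v \<in> iterated_sumset B l"
  then have "u + v \<in> iterated_sumset B (k + l)" by (intro iterated_sumset_add)
  moreover have "u + u' + (v + v') = u + v + (u' + v')" by (simp add: ac_simps)
  ultimately show "Poly_Mapping.keys (u + u' + (v + v')) \<subseteq> {..<n} \<and>
      (\<exists>b\<in>iterated_sumset B (k + l). \<exists>m'. u + u' + (v + v') = b + m')"
    using * by (auto simp: keys_exponent_add)
qed

text \<open>The Rees algebra is spanned by monomials: the right-hand side is a subring that contains the
generators, and conversely a monomial in it is a product of generators.\<close>

lemma rees_carrier_eq:
  assumes eq: "equigenerated n t B"
  shows "rees_carrier (mpols {..<n}) (monomial_ideal n B) =
    {p :: 'k::field mpol poly. \<forall>k. poly.coeff p k \<in> monoid_algebra (rees_exponents n B k)}"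
    (is "?R = ?Q")
proof
  let ?A = "mpols {..<n} :: 'k mpol set"
  let ?U = "(\<lambda>b. Poly_Mapping.single b 1) ` B :: 'k mpol set"
  have U: "?U \<subseteq> ?A" using keys_gen[OF eq] by (fastforce simp: mpols_def)
  have A: "cring (ring_on ?A)" by (rule mpol_ring_cring)
  let ?gens = "(\<lambda>a. [:a:]) ` ?A \<union> (\<lambda>u. [:0, u:]) ` ?U"
  have R: "?R = generate_ring (ring_on (upols ?A)) ?gens"
    by (rule rees_carrier_generators[OF A uminus_in_mpols U])
  have P: "cring (ring_on (upols ?A))" by (rule upols_cring[OF A uminus_in_mpols])
  then interpret P: cring "ring_on (upols ?A)" .
  have Q_upols: "?Q \<subseteq> upols ?A"
    by (auto simp: upols_def mpols_def monoid_algebra_def rees_exponents_def)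
  have "subring ?Q (ring_on (upols ?A))"
  proof (rule P.subringI)
    show "?Q \<subseteq> carrier (ring_on (upols ?A))" using Q_upols by simp
    show "\<one>\<^bsub>ring_on (upols ?A)\<^esub> \<in> ?Q"
      by (auto simp: monoid_algebra_def rees_exponents_def)
    fix p q assume p: "p \<in> ?Q" and q: "q \<in> ?Q"
    have "- p \<in> ?Q" using p by (simp add: uminus_in_monoid_algebra)
    then show "\<ominus>\<^bsub>ring_on (upols ?A)\<^esub> p \<in> ?Q"
      using ring_on_a_inv[OF P subsetD[OF Q_upols p] subsetD[OF Q_upols]] by simp
    show "p \<oplus>\<^bsub>ring_on (upols ?A)\<^esub> q \<in> ?Q" using p q by (simp add: add_in_monoid_algebra)
    have "poly.coeff p i * poly.coeff q (k - i) \<in> monoid_algebra (rees_exponents n B k)"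
      if "i \<le> k" for i k
      unfolding monoid_algebra_def
    proof safe
      fix m assume "m \<in> Poly_Mapping.keys (poly.coeff p i * poly.coeff q (k - i))"
      then obtain a b where m: "m = a + b" and "a \<in> Poly_Mapping.keys (poly.coeff p i)"
        "b \<in> Poly_Mapping.keys (poly.coeff q (k - i))"
        using keys_mult by blast
      then have "a \<in> rees_exponents n B i" "b \<in> rees_exponents n B (k - i)"
        using p q by (auto simp: monoid_algebra_def)
      from rees_exponents_add[OF this] show "m \<in> rees_exponents n B k" using m that by simp
    qed
    then show "p \<otimes>\<^bsub>ring_on (upols ?A)\<^esub> q \<in> ?Q"
      by (auto simp: coeff_mult intro!: sum_in_monoid_algebra)
  qed
  moreover have "?gens \<subseteq> ?Q"
  proof (intro Un_least image_subsetI CollectI allI)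
    fix a k assume "a \<in> ?A"
    then show "poly.coeff [:a:] k \<in> monoid_algebra (rees_exponents n B k)"
      by (cases k) (auto simp: monoid_algebra_def rees_exponents_def mpols_def)
  next
    fix u k assume "u \<in> ?U"
    then obtain b where b: "b \<in> B" "u = Poly_Mapping.single b 1" by blast
    have "b \<in> rees_exponents n B 1"
      using b keys_gen[OF eq] unfolding rees_exponents_def by (auto intro!: exI[of _ 0] bexI[of _ b])
    then show "poly.coeff [:0, u:] k \<in> monoid_algebra (rees_exponents n B k)"
      using b by (auto simp: monoid_algebra_def coeff_pCons split: nat.split)
  qed
  ultimately show "?R \<subseteq> ?Q"
    unfolding R using rees_gens_subset[OF A U]
    by (intro P.generate_ring_min_subring1) (simp_all only: ring_on_simps)

  have incl: "x \<in> ?R" if "x \<in> ?gens" for x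
    unfolding R using that by (rule generate_ring.incl)
  have mult: "x * y \<in> ?R" if "x \<in> ?R" "y \<in> ?R" for x y
    using generate_ring.eng_mult[of x "ring_on (upols ?A)" ?gens y] that unfolding R by simp
  have one: "1 \<in> ?R"
    using generate_ring.one[of "ring_on (upols ?A)" ?gens] unfolding R by simp
  have add: "x + y \<in> ?R" if "x \<in> ?R" "y \<in> ?R" for x y
    using generate_ring.eng_add[of x "ring_on (upols ?A)" ?gens y] that unfolding R by simp
  have zero: "0 \<in> ?R" using incl[of "[:0:]"] zero_in_mpols by fastforce
  have sum: "(\<And>i. i \<in> I \<Longrightarrow> f i \<in> ?R) \<Longrightarrow> sum f I \<in> ?R" for f and I :: "'z set"
    by (induction I rule: infinite_finite_induct) (auto intro: zero add)
  have gen_power: "Polynomial.monom (Poly_Mapping.single b 1) k \<in> ?R" if "b \<in> iterated_sumset B k" for b k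
    using that
  proof (induction k arbitrary: b)
    case 0
    then show ?case using one by (simp add: monom_0 one_pCons)
  next
    case (Suc k)
    then obtain b' m where b: "b = b' + m" "b' \<in> B" "m \<in> iterated_sumset B k" by auto
    have "[:0, Poly_Mapping.single b' 1:] * Polynomial.monom (Poly_Mapping.single m 1) k \<in> ?R"
      by (rule mult[OF incl Suc.IH[OF b(3)]]) (use b(2) in blast)
    moreover have "[:0, Poly_Mapping.single b' 1:] = Polynomial.monom (Poly_Mapping.single b' (1::'k)) 1"
      by (simp add: monom_Suc monom_0)
    ultimately show ?case by (simp add: mult_monom mult_single b(1))
  qed
  have term_in: "Polynomial.monom (Poly_Mapping.single m c) k \<in> ?R" if "m \<in> rees_exponents n B k" for m k c
  proof -
    obtain b m' where b: "m = b + m'" "b \<in> iterated_sumset B k" "Poly_Mapping.keys m \<subseteq> {..<n}"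
      using \<open>m \<in> _\<close> by (auto simp: rees_exponents_def)
    have "Poly_Mapping.single m' c \<in> ?A" using b by (simp add: mpols_def keys_exponent_add)
    then have "[:Poly_Mapping.single m' c:] * Polynomial.monom (Poly_Mapping.single b 1) k \<in> ?R"
      by (intro mult[OF incl gen_power[OF b(2)]]) blast
    then show ?thesis by (simp add: smult_monom mult_single b(1) add.commute)
  qed
  show "?Q \<subseteq> ?R"
  proof
    fix p :: "'k mpol poly" assume "p \<in> ?Q"
    then have "m \<in> rees_exponents n B k" if "m \<in> Poly_Mapping.keys (poly.coeff p k)" for m k
      using that by (auto simp: monoid_algebra_def)
    then have "(\<Sum>k\<le>degree p. \<Sum>m\<in>Poly_Mapping.keys (poly.coeff p k).
        Polynomial.monom (Poly_Mapping.single m (Poly_Mapping.lookup (poly.coeff p k) m)) k) \<in> ?R"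
      by (intro sum term_in)
    then show "p \<in> ?R" by (simp only: poly_sum_monom_single[of p, symmetric])
  qed
qed

text \<open>On the Rees algebra, total degrees in the coefficient of \<open>s ^ k\<close> are at least \<open>k * t\<close>. A product of
monomials has the minimal degree exactly if both factors have it, so taking minimal parts is
multiplicative.\<close>

lemma fiber_map_mult:
  fixes p q :: "'k::field mpol poly"
  assumes eq: "equigenerated n t B"
    and p: "\<And>k. poly.coeff p k \<in> monoid_algebra (rees_exponents n B k)"
    and q: "\<And>k. poly.coeff q k \<in> monoid_algebra (rees_exponents n B k)"
  shows "fiber_map t (p * q) = fiber_map t p * fiber_map t q"
proof -
  have "minimal_part t (p * q) = minimal_part t p * minimal_part t q"
  proof (rule poly_eqI)
    fix k
    have "restrict_keys {m. tdeg m = k * t} (poly.coeff p i * poly.coeff q (k - i))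
        = restrict_keys {m. tdeg m = i * t} (poly.coeff p i)
          * restrict_keys {m. tdeg m = (k - i) * t} (poly.coeff q (k - i))" if "i \<le> k" for i
    proof (rule restrict_keys_mult)
      fix a b assume "a \<in> Poly_Mapping.keys (poly.coeff p i)" "b \<in> Poly_Mapping.keys (poly.coeff q (k - i))"
      then have "i * t \<le> tdeg a" "(k - i) * t \<le> tdeg b"
        using p q tdeg_rees_exponents[OF eq] unfolding monoid_algebra_def by blast+
      moreover have "k * t = i * t + (k - i) * t" using that by (simp flip: add_mult_distrib)
      ultimately show "a + b \<in> {m. tdeg m = k * t}
          \<longleftrightarrow> a \<in> {m. tdeg m = i * t} \<and> b \<in> {m. tdeg m = (k - i) * t}"
        by (auto simp: tdeg_add)
    qed
    then show "poly.coeff (minimal_part t (p * q)) k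
        = poly.coeff (minimal_part t p * minimal_part t q) k"
      by (simp add: coeff_mult coeff_minimal_part restrict_keys_sum)
  qed
  then show ?thesis by (simp add: fiber_map_def)
qed

lemma fiber_map_Const: "fiber_map t [:Const c:] = Const c"
  using fiber_map_monom[of 0 0 t c] by (simp add: Const_def monom_0)

lemma fiber_map_image:
  assumes eq: "equigenerated n t B"
  shows "fiber_map t ` rees_carrier (mpols {..<n}) (monomial_ideal n B) =
    (monoid_algebra (monoid_span B) :: 'k::field mpol set)"
  unfolding rees_carrier_eq[OF eq]
proof (intro equalityI image_subsetI subsetI)
  fix p :: "'k mpol poly"
  assume p: "p \<in> {p. \<forall>k. poly.coeff p k \<in> monoid_algebra (rees_exponents n B k)}"
  show "fiber_map t p \<in> monoid_algebra (monoid_span B)"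
    unfolding monoid_algebra_def
  proof safe
    fix m assume "m \<in> Poly_Mapping.keys (fiber_map t p)"
    then have m: "t dvd tdeg m" "m \<in> Poly_Mapping.keys (poly.coeff p (tdeg m div t))"
      by (auto simp: in_keys_iff lookup_fiber_map[OF t_pos[OF eq]] when_def split: if_splits)
    define k where "k = tdeg m div t"
    have "m \<in> rees_exponents n B k" using p m(2) by (auto simp: monoid_algebra_def k_def)
    then obtain b m' where b: "m = b + m'" "b \<in> iterated_sumset B k"
      by (auto simp: rees_exponents_def)
    have "tdeg m = k * t" using m(1) by (simp add: k_def)
    then have "m' = 0" using b tdeg_iterated_sumset[OF eq b(2)] by (simp add: tdeg_add)
    then show "m \<in> monoid_span B" using b by (auto simp: monoid_span_def)
  qed
next
  fix q :: "'k mpol" assume q: "q \<in> monoid_algebra (monoid_span B)"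
  define p where "p = (\<Sum>m\<in>Poly_Mapping.keys q.
    Polynomial.monom (Poly_Mapping.single m (Poly_Mapping.lookup q m)) (tdeg m div t))"
  have m: "tdeg m = tdeg m div t * t \<and> m \<in> iterated_sumset B (tdeg m div t)
      \<and> m \<in> rees_exponents n B (tdeg m div t)"
    if mq: "m \<in> Poly_Mapping.keys q" for m
  proof -
    obtain k where k: "m \<in> iterated_sumset B k"
      using q mq by (auto simp: monoid_algebra_def monoid_span_def)
    then have "tdeg m div t = k" using tdeg_iterated_sumset[OF eq] t_pos[OF eq] by simp
    moreover have "m \<in> rees_exponents n B k"
      using k keys_iterated_sumset[OF eq k] by (auto simp: rees_exponents_def intro!: bexI[of _ m] exI[of _ 0])
    ultimately show ?thesis using k tdeg_iterated_sumset[OF eq] by auto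
  qed
  have "fiber_map t p = q"
    unfolding p_def fiber_map_sum
    by (subst (3) poly_mapping_sum_single) (intro sum.cong refl fiber_map_monom, use m in blast)
  moreover have "poly.coeff p k \<in> monoid_algebra (rees_exponents n B k)" for k
    unfolding p_def coeff_sum using m
    by (intro sum_in_monoid_algebra) (auto simp: single_in_monoid_algebra zero_in_monoid_algebra)
  ultimately show "q \<in> fiber_map t ` {p. \<forall>k. poly.coeff p k \<in> monoid_algebra (rees_exponents n B k)}"
    by blast
qed

lemma monomial_ideal_subset:
  assumes eq: "equigenerated n t B"
  shows "(monomial_ideal n B :: 'k::field mpol set) \<subseteq> mpols {..<n}"
proof -
  interpret cring "mpol_ring {..<n} :: 'k mpol ring" by (rule mpol_ring_cring)
  have "(\<lambda>b. Poly_Mapping.single b (1::'k)) ` B \<subseteq> mpols {..<n}"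
    using keys_gen[OF eq] by (fastforce simp: mpols_def)
  from genideal_ideal[of "(\<lambda>b. Poly_Mapping.single b (1::'k)) ` B"] this show ?thesis
    by (auto dest!: ideal.axioms(1) additive_subgroup.a_subset)
qed

lemma rees_algebra_cring:
  assumes eq: "equigenerated n t B"
  shows "cring (rees_algebra (mpols {..<n}) (monomial_ideal n B :: 'k::field mpol set))"
  by (rule rees_cring[OF mpol_ring_cring uminus_in_mpols monomial_ideal_subset[OF eq]])

lemma fiber_map_hom:
  assumes eq: "equigenerated n t B"
  shows "ring_hom_ring (rees_algebra (mpols {..<n}) (monomial_ideal n B))
    (ring_on (monoid_algebra (monoid_span B) :: 'k::field mpol set)) (fiber_map t)"
proof (rule ring_hom_ringI)
  show "ring (rees_algebra (mpols {..<n}) (monomial_ideal n B :: 'k mpol set))"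
    using rees_algebra_cring[OF eq] by (rule cring.axioms)
  show "ring (ring_on (monoid_algebra (monoid_span B) :: 'k mpol set))"
    using monoid_algebra_cring[OF exponent_monoid_monoid_span] by (rule cring.axioms)
  show "fiber_map t x \<in> carrier (ring_on (monoid_algebra (monoid_span B)))"
    if "x \<in> carrier (rees_algebra (mpols {..<n}) (monomial_ideal n B))" for x :: "'k mpol poly"
    using that fiber_map_image[OF eq] by auto
  show "fiber_map t \<one>\<^bsub>rees_algebra (mpols {..<n}) (monomial_ideal n B)\<^esub>
      = (\<one>\<^bsub>ring_on (monoid_algebra (monoid_span B))\<^esub> :: 'k mpol)"
    using fiber_map_Const[of t "1::'k"] by (simp add: Const_def one_pCons)
qed (auto simp: fiber_map_add fiber_map_mult[OF eq] rees_carrier_eq[OF eq])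

lemma irrelevant_ideal_lookup_0:
  assumes "a \<in> (irrelevant_ideal n :: 'k::field mpol set)"
  shows "Poly_Mapping.lookup a 0 = 0"
proof -
  interpret cring "mpol_ring {..<n} :: 'k mpol ring" by (rule mpol_ring_cring)
  let ?P = "{p \<in> mpols {..<n}. Poly_Mapping.keys p \<inter> {0} = {}} :: 'k mpol set"
  have "primeideal ?P (mpol_ring {..<n})"
    unfolding mpols_eq_monoid_algebra
    by (intro face_primeideal exponent_monoid_keys_subset face_zero)
  then have "ideal ?P (mpol_ring {..<n})" by (rule primeideal.axioms)
  moreover have "Poly_Mapping.single i (1::nat) \<noteq> 0" for i :: nat
    using tdeg_single[of i 1] by (metis tdeg_0 zero_neq_one)
  then have "Var ` {..<n} \<subseteq> ?P"
    by (auto simp: Var_in_mpols) (auto simp: Var_def split: if_splits)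
  ultimately have "irrelevant_ideal n \<subseteq> ?P"
    unfolding irrelevant_ideal_def by (rule genideal_minimal)
  then show ?thesis using assms by (auto simp: in_keys_iff)
qed

text \<open>Multiplication by a variable leaves the minimal degree, so the extended ideal is contained in the
kernel. Conversely, a monomial above the minimal degree is a sum of \<open>k\<close> generators plus a nonzero
exponent, and it remains in the Rees algebra after a variable has been split off that exponent.\<close>

lemma extended_ideal_eq:
  assumes eq: "equigenerated n t B"
  shows "extended_ideal (mpols {..<n}) (irrelevant_ideal n) (monomial_ideal n B) =
    a_kernel (rees_algebra (mpols {..<n}) (monomial_ideal n B))
      (ring_on (monoid_algebra (monoid_span B) :: 'k::field mpol set)) (fiber_map t)"
  (is "?J = ?K")
proof
  let ?R = "rees_carrier (mpols {..<n}) (monomial_ideal n B :: 'k mpol set)"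
  let ?M = "irrelevant_ideal n :: 'k mpol set"
  interpret R: cring "ring_on ?R" by (rule rees_algebra_cring[OF eq])
  interpret A: cring "mpol_ring {..<n} :: 'k mpol ring" by (rule mpol_ring_cring)
  interpret h: ring_hom_ring "ring_on ?R"
    "ring_on (monoid_algebra (monoid_span B) :: 'k mpol set)" "fiber_map t"
    by (rule fiber_map_hom[OF eq])
  have Vars: "Var ` {..<n} \<subseteq> (mpols {..<n} :: 'k mpol set)" by (auto intro: Var_in_mpols)
  have M: "?M \<subseteq> mpols {..<n}"
    using A.genideal_ideal[of "Var ` {..<n}"] Vars unfolding irrelevant_ideal_def
    by (auto dest!: ideal.axioms(1) additive_subgroup.a_subset)
  have MR: "(\<lambda>a. [:a:]) ` ?M \<subseteq> ?R"
    using M unfolding rees_carrier_def by (blast intro: generate_ring.incl)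
  have K: "?K = {p \<in> ?R. fiber_map t p = 0}" unfolding a_kernel_def' ring_on_simps ..
  have "fiber_map t [:a:] = 0" if "a \<in> ?M" for a
  proof (rule poly_mapping_eqI)
    fix m
    show "Poly_Mapping.lookup (fiber_map t [:a:]) m = Poly_Mapping.lookup 0 m"
    proof (cases "tdeg m div t = 0 \<and> t dvd tdeg m")
      case True
      then have "m = 0" using t_pos[OF eq] by (metis dvd_div_eq_0_iff tdeg_eq_0_iff)
      then show ?thesis
        using irrelevant_ideal_lookup_0[OF that] by (simp add: lookup_fiber_map[OF t_pos[OF eq]])
    next
      case False
      then show ?thesis
        by (cases "tdeg m div t") (auto simp: lookup_fiber_map[OF t_pos[OF eq]] when_def)
    qed
  qed
  then show "?J \<subseteq> ?K"
    unfolding extended_ideal_def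
    by (intro R.genideal_minimal h.kernel_is_ideal) (use MR in \<open>auto simp: K\<close>)

  have J: "ideal ?J (ring_on ?R)"
    unfolding extended_ideal_def using MR by (intro R.genideal_ideal) simp
  have gen: "[:a:] \<in> ?J" if "a \<in> ?M" for a
    using R.genideal_self[of "(\<lambda>a. [:a:]) ` ?M"] MR that unfolding extended_ideal_def by auto
  have term_in: "Polynomial.monom (Poly_Mapping.single m c) k \<in> ?J"
    if m: "m \<in> rees_exponents n B k" "tdeg m \<noteq> k * t" for m k and c :: 'k
  proof -
    obtain b m' where b: "m = b + m'" "b \<in> iterated_sumset B k" "Poly_Mapping.keys m \<subseteq> {..<n}"
      using m by (auto simp: rees_exponents_def)
    then have "m' \<noteq> 0" using m(2) tdeg_iterated_sumset[OF eq] by auto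
    then obtain i where i: "i \<in> Poly_Mapping.keys m'" by fastforce
    obtain m'' where m': "m' = Poly_Mapping.single i 1 + m''" using exponent_split_variable[OF i] .
    have "i < n" using b i by (auto simp: keys_exponent_add)
    then have "Var i \<in> ?M"
      using A.genideal_self[of "Var ` {..<n}"] Vars unfolding irrelevant_ideal_def by auto
    then have "[:Var i:] \<in> ?J" by (rule gen)
    moreover have "b + m'' \<in> rees_exponents n B k"
      using b m' by (auto simp: rees_exponents_def keys_exponent_add)
    then have "Polynomial.monom (Poly_Mapping.single (b + m'') c) k \<in> ?R"
      by (auto simp: rees_carrier_eq[OF eq] single_in_monoid_algebra zero_in_monoid_algebra)
    ultimately have "[:Var i:] * Polynomial.monom (Poly_Mapping.single (b + m'') c) k \<in> ?J"
      by (rule mult_in_ideal_on[OF J])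
    then show ?thesis by (simp add: smult_monom Var_def mult_single b(1) m' add_ac)
  qed
  show "?K \<subseteq> ?J"
  proof
    fix p assume "p \<in> ?K"
    then have p: "p \<in> ?R" "fiber_map t p = 0" by (auto simp: K)
    have "m \<in> rees_exponents n B k \<and> tdeg m \<noteq> k * t"
      if "m \<in> Poly_Mapping.keys (poly.coeff p k)" for m k
    proof
      show "m \<in> rees_exponents n B k" using p(1) that by (auto simp: rees_carrier_eq[OF eq] monoid_algebra_def)
      show "tdeg m \<noteq> k * t"
      proof
        assume "tdeg m = k * t"
        then have "Poly_Mapping.lookup (poly.coeff p k) m = 0"
          using lookup_fiber_map[OF t_pos[OF eq], of p m] p(2) t_pos[OF eq] by simp
        then show False using that by (simp add: in_keys_iff)
      qed
    qed
    then show "p \<in> ?J"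
      by (subst poly_sum_monom_single[of p]) (intro sum_in_ideal_on[OF J] term_in, auto)
  qed
qed

text \<open>The isomorphism theorem for \<open>fiber_map\<close>. The images of the constants are recorded because an
isomorphism with a polynomial ring has to respect them.\<close>

theorem fiber_cone_iso:
  assumes eq: "equigenerated n t B"
  defines "F \<equiv> fiber_cone (mpols {..<n}) (irrelevant_ideal n) (monomial_ideal n B :: 'k::field mpol set)"
  obtains \<psi> where "cring F"
    and "\<psi> \<in> ring_iso F (ring_on (monoid_algebra (monoid_span B)))"
    and "\<And>c. extended_ideal (mpols {..<n}) (irrelevant_ideal n) (monomial_ideal n B)
      +>\<^bsub>rees_algebra (mpols {..<n}) (monomial_ideal n B)\<^esub> [:Const c:] \<in> carrier F"
    and "\<And>c. \<psi> (extended_ideal (mpols {..<n}) (irrelevant_ideal n) (monomial_ideal n B)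
      +>\<^bsub>rees_algebra (mpols {..<n}) (monomial_ideal n B)\<^esub> [:Const c:]) = Const c"
proof -
  let ?R = "rees_carrier (mpols {..<n}) (monomial_ideal n B :: 'k mpol set)"
  interpret R: cring "ring_on ?R" by (rule rees_algebra_cring[OF eq])
  interpret h: ring_hom_ring "ring_on ?R"
    "ring_on (monoid_algebra (monoid_span B) :: 'k mpol set)" "fiber_map t"
    by (rule fiber_map_hom[OF eq])
  have c: "[:Const c:] \<in> carrier (ring_on ?R)" for c
    unfolding rees_carrier_def ring_on_simps by (blast intro: generate_ring.incl Const_in_mpols)
  show ?thesis
  proof (rule that[of "\<lambda>X. the_elem (fiber_map t ` X)"])
    show "cring F" unfolding F_def fiber_cone_def extended_ideal_eq[OF eq]
      by (rule ideal.quotient_is_cring[OF h.kernel_is_ideal R.is_cring])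
    show "(\<lambda>X. the_elem (fiber_map t ` X)) \<in> ring_iso F (ring_on (monoid_algebra (monoid_span B)))"
      unfolding F_def fiber_cone_def extended_ideal_eq[OF eq]
      by (rule h.FactRing_iso_set) (simp add: fiber_map_image[OF eq])
    fix c :: 'k
    show "extended_ideal (mpols {..<n}) (irrelevant_ideal n) (monomial_ideal n B)
        +>\<^bsub>rees_algebra (mpols {..<n}) (monomial_ideal n B)\<^esub> [:Const c:] \<in> carrier F"
      unfolding F_def fiber_cone_def FactRing_simps using c[of c]
      by (simp only: partial_object.select_convs) blast
    show "the_elem (fiber_map t ` (extended_ideal (mpols {..<n}) (irrelevant_ideal n) (monomial_ideal n B)
        +>\<^bsub>rees_algebra (mpols {..<n}) (monomial_ideal n B)\<^esub> [:Const c:])) = Const c"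
      unfolding extended_ideal_eq[OF eq] h.the_elem_simp[OF c[of c]] by (rule fiber_map_Const)
  qed
qed

section \<open>Sums of cyclic windows\<close>

definition cyclic_window :: "nat \<Rightarrow> nat \<Rightarrow> nat \<Rightarrow> (nat \<Rightarrow>\<^sub>0 nat)"
  where "cyclic_window n t j = (\<Sum>s<t. Poly_Mapping.single ((j + s) mod n) 1)"

text \<open>The combination \<open>\<Sum>j<n. a j \<cdot> e\<^sub>j\<close> of the cyclic windows.\<close>

definition window_sum :: "nat \<Rightarrow> nat \<Rightarrow> (nat \<Rightarrow> nat) \<Rightarrow> (nat \<Rightarrow>\<^sub>0 nat)"
  where "window_sum n t a = (\<Sum>j<n. \<Sum>s<t. Poly_Mapping.single ((j + s) mod n) (a j))"

lemma window_sum_add: "window_sum n t (\<lambda>j. a j + b j) = window_sum n t a + window_sum n t b"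
  by (simp add: window_sum_def single_add sum.distrib)

lemma window_sum_0 [simp]: "window_sum n t (\<lambda>_. 0) = 0"
  by (simp add: window_sum_def)

lemma window_sum_cong: "(\<And>j. j < n \<Longrightarrow> a j = b j) \<Longrightarrow> window_sum n t a = window_sum n t b"
  by (simp add: window_sum_def)

lemma window_sum_indicator:
  assumes "j < n"
  shows "window_sum n t (\<lambda>i. of_bool (i = j)) = cyclic_window n t j"
proof -
  have "window_sum n t (\<lambda>i. of_bool (i = j))
      = (\<Sum>i<n. if i = j then cyclic_window n t j else 0)"
    unfolding window_sum_def cyclic_window_def by (intro sum.cong) auto
  then show ?thesis using assms by simp
qed

lemma tdeg_cyclic_window: "tdeg (cyclic_window n t j) = t"
  by (simp add: cyclic_window_def tdeg_sum)

lemma tdeg_window_sum: "tdeg (window_sum n t a) = t * (\<Sum>j<n. a j)"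
  by (simp add: window_sum_def tdeg_sum sum_distrib_left)

lemma keys_window_sum: "Poly_Mapping.keys (window_sum n t a) \<subseteq> {..<n}"
proof
  fix i assume i: "i \<in> Poly_Mapping.keys (window_sum n t a)"
  have "Poly_Mapping.lookup (window_sum n t a) i = 0" if "\<not> i < n"
    unfolding window_sum_def lookup_sum lookup_single
  proof (intro sum.neutral ballI)
    fix j s assume "j \<in> {..<n}"
    then have "(j + s) mod n < n" by (intro mod_less_divisor) auto
    then show "(a j when (j + s) mod n = i) = 0" using that by (auto simp: when_def)
  qed
  then show "i \<in> {..<n}" using i by (auto simp: in_keys_iff)
qed

lemma range_window_sum: "range (window_sum n t) = monoid_span (cyclic_window n t ` {..<n})"
proof
  have "exponent_monoid (range (window_sum n t))"
    unfolding exponent_monoid_def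
  proof (intro conjI ballI)
    show "0 \<in> range (window_sum n t)" 
      using rangeI[of "window_sum n t" "\<lambda>_. 0"] by simp
    fix x y assume "x \<in> range (window_sum n t)" "y \<in> range (window_sum n t)"
    then obtain a b where "x = window_sum n t a" "y = window_sum n t b" by blast
    then have "x + y = window_sum n t (\<lambda>j. a j + b j)" by (simp add: window_sum_add)
    then show "x + y \<in> range (window_sum n t)" by blast
  qed
  moreover have "cyclic_window n t ` {..<n} \<subseteq> range (window_sum n t)"
    by (auto simp: window_sum_indicator[symmetric])
  ultimately show "monoid_span (cyclic_window n t ` {..<n}) \<subseteq> range (window_sum n t)"
    by (rule monoid_span_least)
  let ?S = "monoid_span (cyclic_window n t ` {..<n})"
  have 0: "0 \<in> ?S" and add: "x \<in> ?S \<Longrightarrow> y \<in> ?S \<Longrightarrow> x + y \<in> ?S" for x y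
    using exponent_monoid_monoid_span[of "cyclic_window n t ` {..<n}"]
    by (auto simp: exponent_monoid_def)
  have multiple: "(\<Sum>s<t. Poly_Mapping.single ((j + s) mod n) c) \<in> ?S" if "j < n" for j c
  proof (induction c)
    case (Suc c)
    have "cyclic_window n t j \<in> ?S" using that by (intro monoid_span_incl) auto
    moreover have "(\<Sum>s<t. Poly_Mapping.single ((j + s) mod n) (Suc c))
        = cyclic_window n t j + (\<Sum>s<t. Poly_Mapping.single ((j + s) mod n) c)"
      unfolding cyclic_window_def by (simp flip: sum.distrib single_add)
    ultimately show ?case using add Suc by simp
  qed (use 0 in simp)
  have sum: "(\<Sum>j\<in>J. f j) \<in> ?S" if "\<And>j. j \<in> J \<Longrightarrow> f j \<in> ?S" for J :: "nat set" and f
    using that by (induction J rule: infinite_finite_induct) (auto intro: 0 add)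
  show "range (window_sum n t) \<subseteq> ?S"
    unfolding window_sum_def by (intro image_subsetI sum multiple) auto
qed

text \<open>The windows that contain a position are the \<open>t\<close> windows that start at this position or at one of the
\<open>t - 1\<close> positions before it. Reading off the coordinate at the last position of window \<open>i\<close> avoids
subtraction modulo \<open>n\<close>: it is the sum of the coefficients over the window \<open>i, \<dots>, i + t - 1\<close>.\<close>

lemma lookup_window_sum:
  assumes "0 < n"
  shows "Poly_Mapping.lookup (window_sum n t a) ((i + (t - 1)) mod n) = (\<Sum>s<t. a ((i + s) mod n))"
proof -
  let ?p = "(i + (t - 1)) mod n"
  have "Poly_Mapping.lookup (window_sum n t a) ?p = (\<Sum>s<t. \<Sum>j<n. a j when (j + s) mod n = ?p)"
    unfolding window_sum_def lookup_sum lookup_single by (rule sum.swap)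
  also have "\<dots> = (\<Sum>s<t. a ((i + (t - Suc s)) mod n))"
  proof (rule sum.cong)
    fix s assume s: "s \<in> {..<t}"
    let ?q = "(i + (t - Suc s)) mod n"
    have eq: "i + (t - 1) = i + (t - Suc s) + s" using s by simp
    have "(j + s) mod n = ?p \<longleftrightarrow> j = ?q" if "j < n" for j
    proof -
      have "(j + s) mod n = ?p \<longleftrightarrow> [j = i + (t - Suc s)] (mod n)"
        unfolding eq by (simp add: cong_def[symmetric] cong_add_rcancel_nat)
      then show ?thesis using that by (auto simp: cong_def)
    qed
    then have "(\<Sum>j<n. a j when (j + s) mod n = ?p) = (\<Sum>j<n. if j = ?q then a j else 0)"
      by (intro sum.cong) (auto simp: when_def)
    then show "(\<Sum>j<n. a j when (j + s) mod n = ?p) = a ?q" using assms by simp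
  qed simp
  also have "\<dots> = (\<Sum>s<t. a ((i + s) mod n))"
    by (rule sum.nat_diff_reindex[of "\<lambda>s. a ((i + s) mod n)"])
  finally show ?thesis .
qed

lemma keys_cyclic_window: "j < n \<Longrightarrow> Poly_Mapping.keys (cyclic_window n t j) \<subseteq> {..<n}"
  by (metis window_sum_indicator keys_window_sum)

lemma sum_window_shift:
  fixes f :: "nat \<Rightarrow> 'a::ab_group_add"
  shows "(\<Sum>s<t. f (Suc i + s)) = (\<Sum>s<t. f (i + s)) - f i + f (i + t)"
proof -
  have "f i + (\<Sum>s<t. f (Suc i + s)) = (\<Sum>s<Suc t. f (i + s))"
    by (subst sum.lessThan_Suc_shift) simp
  also have "\<dots> = (\<Sum>s<t. f (i + s)) + f (i + t)" by simp
  finally show ?thesis by (simp add: algebra_simps)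
qed

text \<open>The differences of the coefficients of two equal combinations have vanishing sums over all windows.
Moving a window by one step removes its first coefficient and adds the one \<open>t\<close> places later.\<close>

lemma window_sum_eq_imp_periodic:
  assumes eq: "window_sum n t a = window_sum n t c" and "0 < n"
  shows "int (a ((i + t) mod n)) - int (c ((i + t) mod n)) = int (a (i mod n)) - int (c (i mod n))"
proof -
  define Z where "Z i = int (a (i mod n)) - int (c (i mod n))" for i
  have 0: "(\<Sum>s<t. Z (i + s)) = 0" for i
  proof -
    have "(\<Sum>s<t. a ((i + s) mod n)) = (\<Sum>s<t. c ((i + s) mod n))"
      using lookup_window_sum[OF \<open>0 < n\<close>, of t a i] lookup_window_sum[OF \<open>0 < n\<close>, of t c i] eq by simp
    then have "(\<Sum>s<t. int (a ((i + s) mod n))) = (\<Sum>s<t. int (c ((i + s) mod n)))"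
      by (metis of_nat_sum)
    then show ?thesis by (simp add: Z_def sum_subtractf)
  qed
  have "Z (i + t) = Z i" using sum_window_shift[of Z i t] 0[of i] 0[of "Suc i"] by simp
  then show ?thesis by (simp add: Z_def)
qed

lemma periodic_gcd:
  fixes f :: "nat \<Rightarrow> 'a"
  assumes p: "\<And>i. f (i + p) = f i" and q: "\<And>i. f (i + q) = f i" and "p \<noteq> 0"
  shows "f i = f (i mod gcd p q)"
proof -
  have mult: "f (i + r * x) = f i" if "\<And>i. f (i + r) = f i" for r x i
  proof (induction x)
    case (Suc x)
    have "f (i + r * Suc x) = f (i + r * x + r)" by (simp add: algebra_simps)
    then show ?case using Suc that by simp
  qed simp
  obtain x y where xy: "p * x = q * y + gcd p q" using bezout_nat[OF \<open>p \<noteq> 0\<close>] by blast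
  have "f (i + gcd p q) = f i" for i
  proof -
    have "f (i + gcd p q) = f (i + gcd p q + q * y)" by (simp add: mult[OF q])
    also have "\<dots> = f (i + p * x)" by (simp add: xy add_ac)
    finally show ?thesis by (simp add: mult[OF p])
  qed
  from mult[OF this, of "i mod gcd p q" "i div gcd p q"] show ?thesis by simp
qed

text \<open>The differences \<open>a j - c j\<close> have period \<open>gcd n t\<close>, so the inequality between the first coefficients
spreads to all of them. It is an equality because total degrees show that the coefficients have the
same sum.\<close>

lemma window_sum_determined_by_initial_order:
  assumes eq: "window_sum n t a = window_sum n t c" and "0 < n" and "0 < t"
    and le: "\<And>j. j < gcd n t \<Longrightarrow> c j \<le> a j" and "j < n"
  shows "c j = a j"
proof -
  define Z where "Z i = int (a (i mod n)) - int (c (i mod n))" for i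
  have "c j \<le> a j" if "j < n" for j
  proof -
    have "Z j = Z (j mod gcd n t)"
      using \<open>0 < n\<close> window_sum_eq_imp_periodic[OF eq \<open>0 < n\<close>]
      by (intro periodic_gcd) (auto simp: Z_def)
    moreover have d: "j mod gcd n t < gcd n t" using \<open>0 < n\<close> by simp
    moreover have "gcd n t \<le> n" using \<open>0 < n\<close> by (simp add: gcd_le1_nat)
    ultimately show ?thesis using le[OF d] that by (simp add: Z_def)
  qed
  moreover have "(\<Sum>j<n. c j) = (\<Sum>j<n. a j)"
    using tdeg_window_sum[of n t a] tdeg_window_sum[of n t c] eq \<open>0 < t\<close> by simp
  ultimately show ?thesis using \<open>j < n\<close> by (intro sum_mono_inv[of c "{..<n}" a j]) auto
qed

text \<open>If two windows agreed, the indicator of \<open>j\<close> would take the same value at \<open>j\<close> and at \<open>j + t\<close>.\<close>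

lemma cyclic_window_inj:
  assumes "0 < t" and "t < n"
  shows "inj_on (cyclic_window n t) {..<n}"
proof (rule inj_onI, rule ccontr)
  fix j k assume jk: "j \<in> {..<n}" "k \<in> {..<n}" "cyclic_window n t j = cyclic_window n t k" "j \<noteq> k"
  then have eq: "window_sum n t (\<lambda>i. of_bool (i = j)) = window_sum n t (\<lambda>i. of_bool (i = k))"
    by (simp add: window_sum_indicator)
  have "(j + t) mod n = j"
    using window_sum_eq_imp_periodic[OF eq, of j] jk by (auto simp: of_bool_def split: if_splits)
  then have "[j + t = j + 0] (mod n)" using jk by (simp add: cong_def)
  then have "n dvd t" by (simp only: cong_add_lcancel_nat cong_0_iff)
  then show False using assms nat_dvd_not_less by blast
qed

text \<open>The number of members of a residue class in a window of length \<open>t\<close> does not change when the window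
moves by one step, since \<open>d\<close> divides \<open>t\<close>, and moving the window amounts to changing the class.\<close>

lemma window_residue_count:
  fixes d t j c :: nat
  assumes "d dvd t" and "c < d"
  shows "(\<Sum>s<t. of_bool ((j + s) mod d = c)) = (\<Sum>s<t. of_bool (s mod d = 0) :: int)"
proof -
  have shift: "(\<Sum>s<t. of_bool ((j + s) mod d = c)) = (\<Sum>s<t. of_bool (s mod d = c) :: int)" for j c
  proof (induction j)
    case (Suc j)
    have "(j + t) mod d = j mod d" using \<open>d dvd t\<close> by (auto elim: dvdE)
    then show ?case
      using sum_window_shift[of "\<lambda>i. of_bool (i mod d = c) :: int" j t] Suc by simp
  qed simp
  have "s mod d = c \<longleftrightarrow> (d - c + s) mod d = 0" for s
  proof -
    have "s mod d = c \<longleftrightarrow> [s = c] (mod d)" using \<open>c < d\<close> by (simp add: cong_def)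
    also have "\<dots> \<longleftrightarrow> [d - c + s = d - c + c] (mod d)" by (simp add: cong_add_lcancel_nat)
    finally show ?thesis using \<open>c < d\<close> by (simp add: cong_def)
  qed
  then show ?thesis using shift[of j c] shift[of "d - c" 0] by simp
qed

text \<open>The right-hand side is independent of \<open>c\<close>: the coordinate sums over all residue classes agree.\<close>

lemma window_sum_balanced:
  assumes "d dvd n" and "d dvd t" and "c < d" and "0 < n"
  shows "(\<Sum>i | i < n \<and> i mod d = c. int (Poly_Mapping.lookup (window_sum n t a) i))
    = (\<Sum>j<n. int (a j)) * (\<Sum>s<t. of_bool (s mod d = 0))"
proof -
  let ?I = "{i. i < n \<and> i mod d = c}"
  have "(\<Sum>i\<in>?I. int (Poly_Mapping.lookup (window_sum n t a) i))
      = (\<Sum>i\<in>?I. \<Sum>j<n. \<Sum>s<t. int (a j) * of_bool ((j + s) mod n = i))"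
    by (intro sum.cong refl) (simp add: window_sum_def lookup_sum lookup_single when_def if_distrib
        of_bool_def cong: if_cong)
  also have "\<dots> = (\<Sum>j<n. \<Sum>s<t. \<Sum>i\<in>?I. int (a j) * of_bool ((j + s) mod n = i))"
    by (subst sum.swap, rule sum.cong, rule refl, rule sum.swap)
  also have "\<dots> = (\<Sum>j<n. \<Sum>s<t. int (a j) * of_bool ((j + s) mod d = c))"
  proof (intro sum.cong refl)
    fix j s
    have "(\<Sum>i\<in>?I. int (a j) * of_bool ((j + s) mod n = i))
        = (if (j + s) mod n \<in> ?I then int (a j) else 0)"
      by (simp add: of_bool_def if_distrib cong: if_cong)
    moreover have "(j + s) mod n \<in> ?I \<longleftrightarrow> (j + s) mod d = c"
      using \<open>0 < n\<close> by (simp add: mod_mod_cancel[OF \<open>d dvd n\<close>])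
    ultimately show "(\<Sum>i\<in>?I. int (a j) * of_bool ((j + s) mod n = i))
        = int (a j) * of_bool ((j + s) mod d = c)" by simp
  qed
  also have "\<dots> = (\<Sum>j<n. int (a j)) * (\<Sum>s<t. of_bool (s mod d = 0))"
    by (simp add: sum_distrib_left[symmetric] window_residue_count[OF assms(2,3)] sum_distrib_right)
  finally show ?thesis .
qed

text \<open>The coordinate \<open>0\<close> and those from \<open>d\<close> on give the coordinate sum of the class of \<open>0\<close>. This is also
the sum of every other class \<open>c\<close>, in which only the coordinate at \<open>c\<close> itself is unknown.\<close>

lemma window_sum_coordinates_inj:
  assumes "d dvd n" and "d dvd t" and "0 < d" and "0 < n"
  shows "inj_on (\<lambda>m. restrict (Poly_Mapping.lookup m) (insert 0 {d..<n})) (range (window_sum n t))"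
proof (rule inj_onI, clarify)
  fix a b
  let ?A = "Poly_Mapping.lookup (window_sum n t a)" and ?B = "Poly_Mapping.lookup (window_sum n t b)"
  assume "restrict ?A (insert 0 {d..<n}) = restrict ?B (insert 0 {d..<n})"
  then have eq: "?A i = ?B i" if "i \<in> insert 0 {d..<n}" for i
    using that by (metis restrict_apply')
  have "d \<le> n" using assms dvd_imp_le by blast
  have split: "(\<Sum>i | i < n \<and> i mod d = c. f i) = f c + (\<Sum>i | i \<in> {d..<n} \<and> i mod d = c. f i)"
    if "c < d" for c and f :: "nat \<Rightarrow> int"
  proof -
    have "{i. i < n \<and> i mod d = c} = insert c {i. i \<in> {d..<n} \<and> i mod d = c}"
      using that \<open>d \<le> n\<close> by (auto simp: not_less) (metis mod_less not_le)
    moreover have "finite {i. i \<in> {d..<n} \<and> i mod d = c}"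
      by (rule finite_subset[of _ "{..<n}"]) auto
    ultimately show ?thesis using that by simp
  qed
  have rest: "(\<Sum>i | i \<in> {d..<n} \<and> i mod d = c. int (?A i))
      = (\<Sum>i | i \<in> {d..<n} \<and> i mod d = c. int (?B i))" for c
    using eq by (intro sum.cong) auto
  note bal = window_sum_balanced[OF assms(1,2) _ \<open>0 < n\<close>]
  have "(\<Sum>i | i < n \<and> i mod d = 0. int (?A i)) = (\<Sum>i | i < n \<and> i mod d = 0. int (?B i))"
    unfolding split[OF \<open>0 < d\<close>] rest using eq[of 0] by simp
  then have classes: "(\<Sum>i | i < n \<and> i mod d = c. int (?A i)) = (\<Sum>i | i < n \<and> i mod d = c. int (?B i))"
    if "c < d" for c
    unfolding bal[OF \<open>0 < d\<close>] bal[OF that] .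
  show "window_sum n t a = window_sum n t b"
  proof (rule poly_mapping_eqI)
    fix i
    consider "i \<in> insert 0 {d..<n}" | "n \<le> i" | "i < d" by fastforce
    then show "?A i = ?B i"
    proof cases
      case 1
      then show ?thesis by (rule eq)
    next
      case 2
      then show ?thesis
        using keys_window_sum by (metis in_keys_iff lessThan_iff not_le subsetD)
    next
      case 3
      then show ?thesis
        using classes[of i] unfolding split[OF 3] rest by simp
    qed
  qed
qed

text \<open>Let a sum of two combinations be a combination that avoids the first \<open>r \<ge> gcd n t\<close> windows. The
coefficients of the sum are at least those of the latter on the first \<open>gcd n t\<close> windows, where these
are \<open>0\<close>. So both have the same coefficients, and those of the two summands vanish up to \<open>r\<close> as well.\<close>

lemma window_sum_face:
  assumes "0 < n" and "0 < t" and r: "r = 0 \<or> gcd n t \<le> r" and "r \<le> n"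
  shows "face (range (window_sum n t)) {window_sum n t a | a. \<forall>j<r. a j = 0}" (is "face ?G ?F")
  unfolding face_def
proof (intro conjI ballI)
  show "?F \<subseteq> ?G" by blast
  show "0 \<in> ?F" using window_sum_0 by (auto intro: exI[of _ "\<lambda>_. 0"])
  fix x y assume "x \<in> ?G" "y \<in> ?G"
  then obtain a b where x: "x = window_sum n t a" and y: "y = window_sum n t b" by blast
  show "x + y \<in> ?F \<longleftrightarrow> x \<in> ?F \<and> y \<in> ?F"
  proof (intro iffI)
    assume "x \<in> ?F \<and> y \<in> ?F"
    then obtain a' b' where "x = window_sum n t a'" "\<forall>j<r. a' j = 0"
      "y = window_sum n t b'" "\<forall>j<r. b' j = 0" by blast
    then show "x + y \<in> ?F" by (auto intro!: exI[of _ "\<lambda>j. a' j + b' j"] simp: window_sum_add)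
  next
    assume "x + y \<in> ?F"
    then obtain c where c: "window_sum n t (\<lambda>j. a j + b j) = window_sum n t c" "\<forall>j<r. c j = 0"
      using x y by (auto simp: window_sum_add)
    have "a j = 0 \<and> b j = 0" if "j < r" for j
    proof -
      have "c j = a j + b j"
        using that c(2) r \<open>r \<le> n\<close> assms(1,2)
        by (intro window_sum_determined_by_initial_order[OF c(1)]) auto
      then show ?thesis using c(2) that by simp
    qed
    then show "x \<in> ?F \<and> y \<in> ?F" using x y by blast
  qed
qed

text \<open>The window at \<open>r\<close> cannot be written without the first \<open>r'\<close> windows: relations are determined by
their first \<open>gcd n t\<close> coefficients.\<close>

lemma window_sum_face_strict:
  assumes "0 < n" and "0 < t" and "gcd n t \<le> r'" and "r < r'" and "r' \<le> n"
  shows "{window_sum n t a | a. \<forall>j<r'. a j = 0} \<subset> {window_sum n t a | a. \<forall>j<r. a j = 0}"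
    (is "?F' \<subset> ?F")
proof
  show "?F' \<subseteq> ?F" using \<open>r < r'\<close> by fastforce
  let ?e = "\<lambda>i. of_bool (i = r) :: nat"
  have "window_sum n t ?e \<in> ?F" by (intro CollectI exI[of _ ?e]) auto
  moreover have "window_sum n t ?e \<notin> ?F'"
  proof
    assume "window_sum n t ?e \<in> ?F'"
    then obtain c where c: "window_sum n t ?e = window_sum n t c" "\<forall>j<r'. c j = 0" by auto
    have "c r = ?e r"
      using assms c(2) by (intro window_sum_determined_by_initial_order[OF c(1)]) auto
    then show False using c(2) \<open>r < r'\<close> by simp
  qed
  ultimately show "?F' \<noteq> ?F" by blast
qed

text \<open>For the lower bound, the faces are those that avoid the first \<open>0, d, d + 1, \<dots>, n\<close> windows, where
\<open>d = gcd n t\<close>.\<close>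

lemma krull_dim_window_algebra:
  assumes "0 < n" and "0 < t"
  shows "krull_dim (ring_on (monoid_algebra (range (window_sum n t)) :: 'k::field mpol set))
    = enat (n - gcd n t + 1)"
proof (rule antisym)
  let ?d = "gcd n t" and ?G = "range (window_sum n t)"
  have d: "0 < ?d" "?d \<le> n" using assms by (auto simp: gcd_le1_nat)
  have G: "exponent_monoid ?G" unfolding range_window_sum by (rule exponent_monoid_monoid_span)
  have "card (insert 0 {?d..<n}) = n - ?d + 1"
    using assms by (subst card_insert_disjoint) auto
  then show "krull_dim (ring_on (monoid_algebra ?G :: 'k mpol set)) \<le> enat (n - ?d + 1)"
    using krull_dim_monoid_algebra_le[OF G _ window_sum_coordinates_inj, of ?d] assms d by simp
  \<comment> \<open>The number of avoided windows jumps from \<open>0\<close> to \<open>d\<close> and then grows by one.\<close>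
  define F where "F i = {window_sum n t a | a. \<forall>j<(if i = 0 then 0 else ?d + i - 1). a j = 0}" for i
  show "enat (n - ?d + 1) \<le> krull_dim (ring_on (monoid_algebra ?G :: 'k mpol set))"
  proof (rule face_chain_le_krull_dim[OF G])
    have bound: "?d + i - 1 \<le> n" if "i \<le> n - ?d + 1" for i using that d by linarith
    show "face ?G (F i)" if "i \<le> n - ?d + 1" for i
      unfolding F_def using bound[OF that] by (intro window_sum_face assms) auto
    show "F (Suc i) \<subset> F i" if "i < n - ?d + 1" for i
      unfolding F_def using bound[of "Suc i"] that d(1)
      by (intro window_sum_face_strict assms) auto
  qed
qed

section \<open>Path ideals of cycles\<close>

text \<open>A polynomial ring in \<open>m\<close> variables needs \<open>m \<le> n - gcd n t + 1\<close> by dimension and \<open>n \<le> m\<close> because the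
\<open>n\<close> windows are indecomposable. For coprime \<open>n\<close> and \<open>t\<close> the windows generate their monoid freely:
of two equal combinations one has the larger coefficient at \<open>0\<close>, and this single inequality makes
them agree.\<close>

lemma window_algebra_is_polynomial_ring_iff:
  assumes "1 < t" and "t < n"
  shows "is_polynomial_ring (Const :: 'k::field \<Rightarrow> _) (ring_on (monoid_algebra (range (window_sum n t))))
    \<longleftrightarrow> gcd n t = 1"
proof
  let ?G = "range (window_sum n t)"
  have G: "exponent_monoid ?G" unfolding range_window_sum by (rule exponent_monoid_monoid_span)
  assume "is_polynomial_ring (Const :: 'k \<Rightarrow> _) (ring_on (monoid_algebra ?G))"
  then obtain m \<phi> where \<phi>: "\<phi> \<in> ring_iso (mpol_ring {..<m}) (ring_on (monoid_algebra ?G :: 'k mpol set))"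
    "\<And>c. \<phi> (Const c) = Const c"
    by (auto simp: is_polynomial_ring_def)
  have "enat m \<le> enat (n - gcd n t + 1)"
    using variables_le_krull_dim[of m, where 'k = 'k]
      krull_dim_ring_iso[OF \<phi>(1) mpol_ring_cring monoid_algebra_cring[OF G]]
      krull_dim_window_algebra[of n t, where 'k = 'k] assms by simp
  moreover have "card {..<n} \<le> m"
  proof (rule indecomposables_le_variables[OF G _ cyclic_window_inj _ _ _ \<phi>])
    show "cyclic_window n t ` {..<n} \<subseteq> ?G"
      unfolding range_window_sum by (auto intro: monoid_span_incl)
    show "cyclic_window n t j \<noteq> 0" for j
      using tdeg_cyclic_window[of n t j] assms by (metis tdeg_0 not_less_zero)
    fix j a b assume "a \<in> ?G" "b \<in> ?G" and e: "a + b = cyclic_window n t j"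
    then obtain u v where "a = window_sum n t u" "b = window_sum n t v" by blast
    then obtain x y where xy: "tdeg a = t * x" "tdeg b = t * y" using tdeg_window_sum by metis
    moreover have "tdeg a + tdeg b = t" using e tdeg_cyclic_window[of n t j] by (metis tdeg_add)
    ultimately have "t * (x + y) = t * 1" by (simp add: algebra_simps)
    then have "x + y = 1" using assms by (metis mult_cancel1 not_less_zero)
    then have "x = 0 \<or> y = 0" by linarith
    then have "tdeg a = 0 \<or> tdeg b = 0" using xy by auto
    then show "a = 0 \<or> b = 0" by simp
  qed (use assms in auto)
  moreover have "0 < gcd n t" "gcd n t \<le> n" using assms by (auto simp: gcd_le1_nat)
  ultimately show "gcd n t = 1" unfolding card_lessThan enat_ord_simps by linarith
next
  assume gcd: "gcd n t = 1"
  let ?V = "{m :: nat \<Rightarrow>\<^sub>0 nat. Poly_Mapping.keys m \<subseteq> {..<n}}"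
  define \<omega> where "\<omega> m = window_sum n t (Poly_Mapping.lookup m)" for m
  have inj: "m = m'" if m: "m \<in> ?V" "m' \<in> ?V" and eq: "\<omega> m = \<omega> m'"
    and le: "Poly_Mapping.lookup m' 0 \<le> Poly_Mapping.lookup m 0" for m m'
  proof (rule poly_mapping_eqI)
    fix i
    show "Poly_Mapping.lookup m i = Poly_Mapping.lookup m' i"
    proof (cases "i < n")
      case True
      then show ?thesis
        using window_sum_determined_by_initial_order[of n t "Poly_Mapping.lookup m" "Poly_Mapping.lookup m'" i]
          eq le assms gcd by (simp add: \<omega>_def)
    next
      case False
      then have "i \<notin> Poly_Mapping.keys m" "i \<notin> Poly_Mapping.keys m'" using m by auto
      then show ?thesis by (simp add: in_keys_iff)
    qed
  qed
  have "inj_on \<omega> ?V"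
  proof (rule inj_onI)
    fix m m' assume "m \<in> ?V" "m' \<in> ?V" "\<omega> m = \<omega> m'"
    then show "m = m'"
      using inj[of m m'] inj[of m' m] nat_le_linear[of "Poly_Mapping.lookup m 0" "Poly_Mapping.lookup m' 0"]
      by metis
  qed
  moreover have "\<omega> ` ?V = range (window_sum n t)"
  proof (intro equalityI subsetI)
    fix x assume "x \<in> range (window_sum n t)"
    then obtain a where x: "x = window_sum n t a" by blast
    define m where "m = (\<Sum>j<n. Poly_Mapping.single j (a j))"
    have lookup: "Poly_Mapping.lookup m i = (if i < n then a i else 0)" for i
      by (simp add: m_def lookup_sum lookup_single when_def)
    then have "m \<in> ?V" by (auto simp: in_keys_iff split: if_splits)
    moreover have "x = \<omega> m" unfolding x \<omega>_def by (rule window_sum_cong) (simp add: lookup)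
    ultimately show "x \<in> \<omega> ` ?V" by blast
  qed (auto simp: \<omega>_def)
  ultimately have "bij_betw \<omega> ?V (range (window_sum n t))" by (simp add: bij_betw_def)
  moreover have zero: "\<omega> 0 = 0" by (simp add: \<omega>_def window_sum_def)
  moreover have "\<omega> (a + b) = \<omega> a + \<omega> b" for a b
    by (simp add: \<omega>_def window_sum_def lookup_add single_add sum.distrib)
  ultimately have "push_exponents \<omega> \<in> ring_iso (mpol_ring {..<n})
      (ring_on (monoid_algebra (range (window_sum n t)) :: 'k mpol set))"
    unfolding mpols_eq_monoid_algebra by (rule monoid_algebra_ring_iso)
  moreover have "push_exponents \<omega> (Const c) = Const c" for c :: 'k
    by (simp add: Const_def push_exponents_single zero)
  ultimately show "is_polynomial_ring (Const :: 'k \<Rightarrow> _) (ring_on (monoid_algebra (range (window_sum n t))))"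
    unfolding is_polynomial_ring_def by blast
qed

lemma prod_Var: "(\<Prod>i\<in>I. Var (f i)) = (Poly_Mapping.single (\<Sum>i\<in>I. Poly_Mapping.single (f i) 1) 1 :: 'a::comm_ring_1 mpol)"
  by (induction I rule: infinite_finite_induct) (auto simp: Var_def mult_single)

text \<open>The three results from which the theorem follows, with the facts on which they rest.\<close>

thm_deps fiber_cone_iso krull_dim_window_algebra window_algebra_is_polynomial_ring_iff

theorem theorem3p1:
  fixes n t :: nat
  assumes "1 < t" and "t < n - 1"
  shows "krull_dim (cycle_fiber_cone n t :: 'k::field mpol poly set ring) = enat (n - gcd n t + 1) \<and>
    (is_polynomial_ring (cycle_fiber_const n t :: 'k \<Rightarrow> _)
       (cycle_fiber_cone n t :: 'k mpol poly set ring) \<longleftrightarrow> gcd n t = 1)"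
proof -
  have n: "0 < n" "0 < t" "t < n" using assms by auto
  let ?B = "cyclic_window n t ` {..<n}"
  have eq: "equigenerated n t ?B"
    using n keys_cyclic_window by (auto simp: equigenerated_def tdeg_cyclic_window)
  have "path_monomials t {..<n} (cycle_edges n) = (\<lambda>b. Poly_Mapping.single b (1::'k)) ` ?B"
    using cycle_path_monomials[of t n] n
    by (auto simp: prod_Var cyclic_window_def image_image setcompr_eq_image lessThan_def)
  then have I: "cycle_path_ideal n t = (monomial_ideal n ?B :: 'k mpol set)"
    by (simp add: cycle_path_ideal_def path_ideal_def)
  let ?A = "ring_on (monoid_algebra (range (window_sum n t)) :: 'k mpol set)"
  have A: "cring ?A"
    unfolding range_window_sum by (intro monoid_algebra_cring exponent_monoid_monoid_span)
  obtain \<psi> where F: "cring (cycle_fiber_cone n t :: 'k mpol poly set ring)"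
    and \<psi>: "\<psi> \<in> ring_iso (cycle_fiber_cone n t :: 'k mpol poly set ring) ?A"
    and const: "\<And>c. cycle_fiber_const n t (c :: 'k) \<in> carrier (cycle_fiber_cone n t)"
      "\<And>c. \<psi> (cycle_fiber_const n t (c :: 'k)) = Const c"
    using fiber_cone_iso[OF eq, where 'k = 'k]
    unfolding cycle_fiber_cone_def cycle_fiber_const_def I range_window_sum by metis
  have "krull_dim (cycle_fiber_cone n t :: 'k mpol poly set ring) = enat (n - gcd n t + 1)"
    using krull_dim_ring_iso[OF \<psi> F A] krull_dim_window_algebra n by metis
  moreover have "is_polynomial_ring (cycle_fiber_const n t :: 'k \<Rightarrow> _) (cycle_fiber_cone n t)
      \<longleftrightarrow> gcd n t = 1"
    using is_polynomial_ring_iso[where \<iota> = "cycle_fiber_const n t" and \<kappa> = Const, OF \<psi> cring.axioms(1)[OF F] const]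
      window_algebra_is_polynomial_ring_iff[OF assms(1) n(3), where 'k = 'k] by simp
  ultimately show ?thesis by blast
qed

end
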